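(* Let $G$ be a finitely-generated group of the form $\mathbb{Z}\ltimes_A H$, where $A\in GL_d(\mathbb{Q})$ and $\mathrm{rank}_{\mathbb{Q}}(H)=d$. Then every faithful action of $G$ by (orientation-preserving) $C^1$ diffeomorphisms of $[0,1]$ can be approximated in the $C^1$ topology by actions by $C^1$ diffeomorphisms that are topologically conjugate to it but for which no Lipschitz conjugacy exists.
   Context: Here $d\ge 1$ and $H$ is a subgroup of $\mathbb{Q}^d$ invariant under $A$ and $A^{-1}$; $\mathrm{rank}_{\mathbb{Q}}(H)$, the $\mathbb{Q}$-rank of $H$, is the smallest $d'$ such that $H$ embeds into $\mathbb{Q}^{d'}$. $\mathbb{Z}\ltimes_A H$ is the semidirect product in which the generator $a$ of $\mathbb{Z}$ acts on $H$ by $a\,b\,a^{-1}=A(b)$, $b\in H$. $\mathrm{Diff}^1_+([0,1])$ is the group of orientation-preserving $C^1$ diffeomorphisms of $[0,1]$. An action $\phi:G\to\mathrm{Diff}^1_+([0,1])$ is approximated in the $C^1$ topology by actions with a given property if, for a fixed finite generating set $S$ of $G$ and every $\varepsilon>0$, there is an action $\phi':G\to\mathrm{Diff}^1_+([0,1])$ with that property satisfying $\|\phi'(c)-\phi(c)\|_{C^1}\le\varepsilon$ for all $c\in S$. A topological conjugacy from $\phi$ to $\phi'$ is a homeomorphism $\varphi$ of $[0,1]$ such that $\phi'(g)=\varphi\circ\phi(g)\circ\varphi^{-1}$ for all $g\in G$; it is a Lipschitz conjugacy if $\varphi$ is Lipschitz. *)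

theory Defs
  imports "HOL-Analysis.Analysis" "HOL-Algebra.Bij" "HOL-Algebra.Generated_Groups"
    "HOL-Algebra.Product_Groups"
begin

section \<open>The groups $\mathbb{Z} \ltimes_A H$\<close>

definition additive_group :: "'a::ab_group_add monoid" where
  "additive_group = \<lparr>carrier = UNIV, monoid.mult = (+), one = 0\<rparr>"

text \<open>
  The ambient space of \<open>H\<close> is the type \<^typ>\<open>rat^'d\<close>.  The target of the embedding has to be
  available for every \<open>n\<close> inside one formula, so it is instead a direct product of copies of the
  additive group of rationals indexed by \<open>{..<n}\<close>.
\<close>

definition rank_Q :: "(rat^'d) set \<Rightarrow> nat" where
  "rank_Q H = (LEAST n. \<exists>f. f \<in> mon (additive_group\<lparr>carrier := H\<rparr>)
                                  (product_group {..<n} (\<lambda>_. additive_group :: rat monoid)))"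

definition mat_powi :: "'a::field^'d^'d \<Rightarrow> int \<Rightarrow> 'a^'d^'d" where
  "mat_powi A m = (if 0 \<le> m then (((**) A) ^^ nat m) (mat 1)
                   else (((**) (matrix_inv A)) ^^ nat (- m)) (mat 1))"

text \<open>
  The pair \<open>(m, x)\<close> stands for \<open>x a\<^sup>m\<close>; the generator \<open>a = (1, 0)\<close> satisfies
  \<open>a (0, x) a\<^sup>-\<^sup>1 = (0, A x)\<close>.
\<close>

definition semidirect_Z :: "rat^'d^'d \<Rightarrow> (rat^'d) set \<Rightarrow> (int \<times> (rat^'d)) monoid" where
  "semidirect_Z A H =
    \<lparr>carrier = UNIV \<times> H,
     monoid.mult = (\<lambda>(m, x) (n, y). (m + n, x + mat_powi A m *v y)),
     one = (0, 0)\<rparr>"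

definition generating_set :: "('g, 'b) monoid_scheme \<Rightarrow> 'g set \<Rightarrow> bool" where
  "generating_set G S \<longleftrightarrow> S \<subseteq> carrier G \<and> generate G S = carrier G"

definition finitely_generated_group :: "('g, 'b) monoid_scheme \<Rightarrow> bool" where
  "finitely_generated_group G \<longleftrightarrow> group G \<and> (\<exists>S. finite S \<and> generating_set G S)"


section \<open>$C^1$ diffeomorphisms of the unit interval\<close>

text \<open>Derivatives are relative to \<open>{0..1}\<close>, hence one-sided at the endpoints.\<close>

definition C1_on_unit :: "(real \<Rightarrow> real) \<Rightarrow> bool" where
  "C1_on_unit f \<longleftrightarrow>
    (\<exists>f'. continuous_on {0..1} f' \<and>
          (\<forall>x\<in>{0..1}. (f has_real_derivative f' x) (at x within {0..1})))"

definition Diff1 :: "(real \<Rightarrow> real) set" where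
  "Diff1 = {f \<in> Bij {0..1}. C1_on_unit f \<and> C1_on_unit (inv_into {0..1} f) \<and>
                           strict_mono_on {0..1} f}"

definition Diff1_group :: "(real \<Rightarrow> real) monoid" where
  "Diff1_group = BijGroup {0..1}\<lparr>carrier := Diff1\<rparr>"

definition C1_norm :: "(real \<Rightarrow> real) \<Rightarrow> real" where
  "C1_norm f = (SUP x\<in>{0..1}. \<bar>f x\<bar>)
             + (SUP x\<in>{0..1}. \<bar>vector_derivative f (at x within {0..1})\<bar>)"


section \<open>Actions, approximation and conjugacy\<close>

definition C1_action :: "('g, 'b) monoid_scheme \<Rightarrow> ('g \<Rightarrow> real \<Rightarrow> real) \<Rightarrow> bool" where
  "C1_action G \<phi> \<longleftrightarrow> \<phi> \<in> hom G Diff1_group"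

definition faithful_C1_action :: "('g, 'b) monoid_scheme \<Rightarrow> ('g \<Rightarrow> real \<Rightarrow> real) \<Rightarrow> bool" where
  "faithful_C1_action G \<phi> \<longleftrightarrow> C1_action G \<phi> \<and> inj_on \<phi> (carrier G)"

text \<open>
  Whether \<open>\<phi>\<close> is approximated does not depend on the finite generating set, so the definition asks
  for approximations with respect to each of them.  For a group that is not finitely generated it
  would hold vacuously.
\<close>

definition C1_approximated_by ::
  "('g, 'b) monoid_scheme \<Rightarrow> ('g \<Rightarrow> real \<Rightarrow> real) \<Rightarrow> (('g \<Rightarrow> real \<Rightarrow> real) \<Rightarrow> bool) \<Rightarrow> bool" where
  "C1_approximated_by G \<phi> P \<longleftrightarrow>
    (\<forall>S. finite S \<and> generating_set G S \<longrightarrow>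
      (\<forall>\<epsilon>>0. \<exists>\<phi>'. C1_action G \<phi>' \<and> P \<phi>' \<and>
                   (\<forall>c\<in>S. C1_norm (\<lambda>x. \<phi>' c x - \<phi> c x) \<le> \<epsilon>)))"

text \<open>Conjugacies may reverse the orientation of the interval.\<close>

definition conjugacy ::
  "('g, 'b) monoid_scheme \<Rightarrow> ('g \<Rightarrow> real \<Rightarrow> real) \<Rightarrow> ('g \<Rightarrow> real \<Rightarrow> real) \<Rightarrow> (real \<Rightarrow> real) \<Rightarrow> bool" where
  "conjugacy G \<phi> \<phi>' h \<longleftrightarrow>
    (\<exists>k. homeomorphism {0..1} {0..1} h k \<and>
         (\<forall>g\<in>carrier G. \<forall>x\<in>{0..1}. \<phi>' g x = h (\<phi> g (k x))))"

definition topologically_conjugate ::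
  "('g, 'b) monoid_scheme \<Rightarrow> ('g \<Rightarrow> real \<Rightarrow> real) \<Rightarrow> ('g \<Rightarrow> real \<Rightarrow> real) \<Rightarrow> bool" where
  "topologically_conjugate G \<phi> \<phi>' \<longleftrightarrow> (\<exists>h. conjugacy G \<phi> \<phi>' h)"

definition Lipschitz_conjugate ::
  "('g, 'b) monoid_scheme \<Rightarrow> ('g \<Rightarrow> real \<Rightarrow> real) \<Rightarrow> ('g \<Rightarrow> real \<Rightarrow> real) \<Rightarrow> bool" where
  "Lipschitz_conjugate G \<phi> \<phi>' \<longleftrightarrow>
    (\<exists>h. conjugacy G \<phi> \<phi>' h \<and> (\<exists>L. L-lipschitz_on {0..1} h))"

end

(*
Every action of a group by C^1 diffeomorphisms that is not trivial has such approximations. Let e be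
a global fixed point and conjugate by h with h' proportional to 1 + eta g(|x - e|), where g is
integrable, tends to infinity at 0 and satisfies g(|f x - e|) / g(|x - e|) -> r_f for every f in the
group, with r_f close to 1 for the generators. The conjugates are again C^1, since the derivative of
h f h^-1 is f' times a ratio that extends continuously to e, and they are C^1 close to the action
for small eta. With H the primitive of g, a conjugacy has the form h o c with c commuting with the
action; if it is Lipschitz then so is c, and H(|c x - e|) = O(|x - c^-1 e|).

If an element s has derivative < 1 at some global fixed point, then Lipschitz maps commuting with s
cannot increase the derivative of s at global fixed points. Take the finite set E of those with
derivative at most some v < 1, let e maximize the derivative on E, and let g(t) be proportional to
t^-delta: this raises the derivative at e above all the others, so c maps E injectively into E - {e},
which is absurd.

Otherwise all derivatives at global fixed points are 1, and any slowly varying g is allowed. Take for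
e the infimum of a nontrivial orbit and group elements g_n with g_n x0 -> e. The behaviour of any c
is controlled along the images under g_n of countably many pairs (z, w) with z rational and w -> e,
and a diagonal choice of H dominates all of these sequences.
*)

theory Submission
  imports Defs
begin

section \<open>Calculus on the unit interval\<close>

abbreviation unit_deriv :: "(real \<Rightarrow> real) \<Rightarrow> real \<Rightarrow> real" where
  "unit_deriv f x \<equiv> vector_derivative f (at x within {0..1})"

lemma unit_deriv_eq:
  assumes "x \<in> {0..1::real}" "(f has_real_derivative d) (at x within {0..1})"
  shows "unit_deriv f x = d"
  using vector_derivative_within_cbox[of 0 1 x f d] assms
  by (simp add: has_real_derivative_iff_has_vector_derivative)

lemma C1_on_unitD:
  assumes "C1_on_unit f"
  shows continuous_on_unit_deriv: "continuous_on {0..1} (unit_deriv f)"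
    and has_unit_deriv: "x \<in> {0..1} \<Longrightarrow> (f has_real_derivative unit_deriv f x) (at x within {0..1})"
proof -
  obtain f' where f': "continuous_on {0..1} f'"
      "\<forall>x\<in>{0..1}. (f has_real_derivative f' x) (at x within {0..1})"
    using assms by (auto simp: C1_on_unit_def)
  have eq: "unit_deriv f x = f' x" if "x \<in> {0..1}" for x
    using unit_deriv_eq[OF that] f'(2) that by simp
  show "continuous_on {0..1} (unit_deriv f)"
    by (rule iffD2[OF continuous_on_cong[OF refl eq] f'(1)])
  show "(f has_real_derivative unit_deriv f x) (at x within {0..1})" if "x \<in> {0..1}"
    using f'(2) eq that by simp
qed

lemma C1_on_unit_cong:
  assumes "C1_on_unit f" "\<And>x. x \<in> {0..1} \<Longrightarrow> f x = g x"
  shows "C1_on_unit g"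
  unfolding C1_on_unit_def
proof (intro exI[of _ "unit_deriv f"] conjI ballI)
  show "continuous_on {0..1} (unit_deriv f)"
    by (rule continuous_on_unit_deriv[OF assms(1)])
  show "(g has_real_derivative unit_deriv f x) (at x within {0..1})" if "x \<in> {0..1}" for x
    by (rule has_field_derivative_transform_within[OF has_unit_deriv[OF assms(1) that] zero_less_one that])
      (rule assms(2))
qed

text \<open>The fundamental theorem of calculus tolerates an exceptional point and the endpoints, so
  \<open>F\<close> is a constant plus the integral of the continuous \<open>D\<close>, which is
  differentiable everywhere. This serves to remove the singular point of a conjugate.\<close>

lemma has_derivative_removable_point:
  fixes F D :: "real \<Rightarrow> real"
  assumes F: "continuous_on {0..1} F" and D: "continuous_on {0..1} D"
    and der: "\<And>y. y \<in> {0<..<1} - {b} \<Longrightarrow> (F has_real_derivative D y) (at y)"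
    and y: "y \<in> {0..1}"
  shows "(F has_real_derivative D y) (at y within {0..1})"
proof -
  have int: "(D has_integral (F u - F 0)) {0..u}" if "u \<in> {0..1}" for u
  proof (rule fundamental_theorem_of_calculus_interior_strong[of "{b}"])
    show "continuous_on {0..u} F"
      using F by (rule continuous_on_subset) (use that in auto)
    show "(F has_vector_derivative D x) (at x)" if "x \<in> {0<..<u} - {b}" for x
      using der[of x] that \<open>u \<in> {0..1}\<close>
      by (auto simp: has_real_derivative_iff_has_vector_derivative)
  qed (use that in auto)
  have eq: "F u = integral {0..u} D + F 0" if "u \<in> {0..1}" for u
    using integral_unique[OF int[OF that]] by simp
  have "((\<lambda>u. integral {0..u} D) has_real_derivative D y) (at y within {0..1})"
    using integral_has_real_derivative[OF D] y by auto
  then have "((\<lambda>u. integral {0..u} D + F 0) has_real_derivative D y) (at y within {0..1})"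
    by (auto intro!: derivative_eq_intros)
  then show ?thesis
    by (rule has_field_derivative_transform_within[OF _ zero_less_one y]) (rule eq[symmetric])
qed

lemma abs_quotient_tendsto_deriv:
  fixes f :: "real \<Rightarrow> real"
  assumes "(f has_real_derivative d) (at e within T)" "f e = e" "d > 0"
  shows "((\<lambda>x. \<bar>f x - e\<bar> / \<bar>x - e\<bar>) \<longlongrightarrow> d) (at e within T)"
proof -
  have "((\<lambda>x. (f x - e) / (x - e)) \<longlongrightarrow> d) (at e within T)"
    using assms(1,2) by (simp add: has_field_derivative_iff)
  from tendsto_rabs[OF this] show ?thesis using assms(3) by (simp add: abs_divide)
qed

section \<open>Basic properties of C^1 diffeomorphisms of the interval\<close>

lemma Diff1D:
  assumes "f \<in> Diff1"
  shows Diff1_Bij: "f \<in> Bij {0..1}" and Diff1_C1: "C1_on_unit f"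
    and Diff1_C1_inv: "C1_on_unit (inv_into {0..1} f)"
    and Diff1_strict_mono: "strict_mono_on {0..1} f"
    and Diff1_bij_betw: "bij_betw f {0..1} {0..1}"
    and Diff1_mem: "x \<in> {0..1} \<Longrightarrow> f x \<in> {0..1}"
    and Diff1_continuous: "continuous_on {0..1} f"
proof -
  show C1: "C1_on_unit f" and "f \<in> Bij {0..1}" "C1_on_unit (inv_into {0..1} f)"
    "strict_mono_on {0..1} f"
    and b: "bij_betw f {0..1} {0..1}" using assms by (auto simp: Diff1_def Bij_def)
  show "x \<in> {0..1} \<Longrightarrow> f x \<in> {0..1}" using b by (rule bij_betwE[rule_format])
  show "continuous_on {0..1} f"
    using has_unit_deriv[OF C1] by (rule DERIV_continuous_on)
qed

lemma Diff1_less: "f \<in> Diff1 \<Longrightarrow> x \<in> {0..1} \<Longrightarrow> y \<in> {0..1} \<Longrightarrow> f x < f y \<longleftrightarrow> x < y"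
  by (rule strict_mono_on_less[OF Diff1_strict_mono])

lemma Diff1_le: "f \<in> Diff1 \<Longrightarrow> x \<in> {0..1} \<Longrightarrow> y \<in> {0..1} \<Longrightarrow> f x \<le> f y \<longleftrightarrow> x \<le> y"
  by (rule strict_mono_on_less_eq[OF Diff1_strict_mono])

text \<open>The inverse is C^1 too, so the chain rule makes the derivative nonzero; monotonicity
  makes the difference quotients nonnegative.\<close>

lemma Diff1_unit_deriv_pos:
  assumes f: "f \<in> Diff1" and x: "x \<in> {0..1}"
  shows "unit_deriv f x > 0"
proof -
  let ?k = "inv_into {0..1} f"
  have kf: "?k (f y) = y" if "y \<in> {0..1}" for y
    using Diff1_bij_betw[OF f] that by (simp add: bij_betw_def)
  have "((?k \<circ> f) has_real_derivative unit_deriv ?k (f x) * unit_deriv f x) (at x within {0..1})"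
  proof (rule DERIV_image_chain)
    show "(?k has_real_derivative unit_deriv ?k (f x)) (at (f x) within f ` {0..1})"
      using has_unit_deriv[OF Diff1_C1_inv[OF f], of "f x"] Diff1_mem[OF f x] Diff1_bij_betw[OF f]
      by (simp add: bij_betw_def)
  qed (use has_unit_deriv[OF Diff1_C1[OF f] x] in simp)
  then have "((\<lambda>y. y) has_real_derivative unit_deriv ?k (f x) * unit_deriv f x) (at x within {0..1})"
    by (rule has_field_derivative_transform_within[where d=1]) (use x kf in auto)
  then have "unit_deriv (\<lambda>y. y) x = unit_deriv ?k (f x) * unit_deriv f x"
    by (rule unit_deriv_eq[OF x])
  moreover have "unit_deriv (\<lambda>y::real. y) x = 1"
    using unit_deriv_eq[OF x DERIV_ident] .
  ultimately have "unit_deriv f x \<noteq> 0" by auto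
  moreover have "unit_deriv f x \<ge> 0"
  proof -
    have lim: "((\<lambda>y. (f y - f x) / (y - x)) \<longlongrightarrow> unit_deriv f x) (at x within {0..1})"
      using has_unit_deriv[OF Diff1_C1[OF f] x] by (simp add: has_field_derivative_iff)
    have "\<forall>\<^sub>F y in at x within {0..1}. (f y - f x) / (y - x) \<ge> 0"
      unfolding eventually_at_filter
    proof (rule always_eventually, intro allI impI)
      fix y assume "y \<noteq> x" "y \<in> {0..1::real}"
      then show "(f y - f x) / (y - x) \<ge> 0"
        using Diff1_le[OF f, of x y] Diff1_le[OF f, of y x] x
        by (cases "x \<le> y") (auto simp: zero_le_divide_iff)
    qed
    moreover have "at x within {0..1} \<noteq> bot"
      using x by (simp add: trivial_limit_within islimpt_Icc)
    ultimately show ?thesis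
      using tendsto_lowerbound[OF lim] by blast
  qed
  ultimately show ?thesis by simp
qed

section \<open>Conjugation by a homeomorphism with one singular point\<close>

lemma unit_homeoD:
  assumes h: "homeomorphism {0..1::real} {0..1::real} h k" and mono: "strict_mono_on {0..1} h"
  shows unit_homeo_endpoints: "h 0 = 0" "h 1 = 1"
    and unit_homeo_inverse_mono: "strict_mono_on {0..1} k"
    and unit_homeo_mem: "x \<in> {0..1} \<Longrightarrow> h x \<in> {0..1}" "x \<in> {0..1} \<Longrightarrow> k x \<in> {0..1}"
    and unit_homeo_inverse: "x \<in> {0..1} \<Longrightarrow> k (h x) = x" "x \<in> {0..1} \<Longrightarrow> h (k x) = x"
proof -
  have im: "h ` {0..1} = {0..1}" "k ` {0..1} = {0..1}"
    using h by (auto simp: homeomorphism_def)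
  show mem: "x \<in> {0..1} \<Longrightarrow> h x \<in> {0..1}" "x \<in> {0..1} \<Longrightarrow> k x \<in> {0..1}" for x
    using im by blast+
  show inv: "x \<in> {0..1} \<Longrightarrow> k (h x) = x" "x \<in> {0..1} \<Longrightarrow> h (k x) = x" for x
    using h unfolding homeomorphism_def by blast+
  have le: "h x \<le> h y \<longleftrightarrow> x \<le> y" if "x \<in> {0..1}" "y \<in> {0..1}" for x y
    by (rule strict_mono_on_less_eq[OF mono that])
  have "h 0 \<le> h (k 0)" "h (k 1) \<le> h 1"
    using le[of 0 "k 0"] le[of "k 1" 1] mem(2)[of 0] mem(2)[of 1] by auto
  then show "h 0 = 0" "h 1 = 1"
    using mem(1)[of 0] mem(1)[of 1] inv(2)[of 0] inv(2)[of 1] by auto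
  show "strict_mono_on {0..1} k"
  proof (rule strict_mono_onI)
    fix x y :: real assume xy: "x \<in> {0..1}" "y \<in> {0..1}" "x < y"
    show "k x < k y"
      using le[OF mem(2)[OF xy(2)] mem(2)[OF xy(1)]] inv(2)[OF xy(1)] inv(2)[OF xy(2)] xy(3)
      by (simp add: not_le[symmetric])
  qed
qed

lemma unit_homeo_interior:
  assumes h: "homeomorphism {0..1::real} {0..1::real} h k" and mono: "strict_mono_on {0..1} h"
    and x: "x \<in> {0<..<1}"
  shows "h x \<in> {0<..<1}" "k x \<in> {0<..<1}"
proof -
  have "h 0 < h x" "h x < h 1"
    using strict_mono_onD[OF mono, of 0 x] strict_mono_onD[OF mono, of x 1] x by auto
  then show "h x \<in> {0<..<1}" using unit_homeo_endpoints[OF h mono] by simp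
  have "k 0 = 0" "k 1 = 1"
    using unit_homeo_endpoints[OF h mono] unit_homeo_inverse(1)[OF h mono, of 0]
      unit_homeo_inverse(1)[OF h mono, of 1] by auto
  moreover have "k 0 < k x" "k x < k 1"
    using strict_mono_onD[OF unit_homeo_inverse_mono[OF h mono], of 0 x]
      strict_mono_onD[OF unit_homeo_inverse_mono[OF h mono], of x 1] x by auto
  ultimately show "k x \<in> {0<..<1}" by simp
qed

lemma Diff1_homeomorphism:
  assumes "f \<in> Diff1"
  shows "homeomorphism {0..1} {0..1} f (inv_into {0..1} f)"
  unfolding homeomorphism_def
proof (intro conjI ballI)
  have b: "bij_betw f {0..1} {0..1}" by (rule Diff1_bij_betw[OF assms])
  show "inv_into {0..1} f (f x) = x" if "x \<in> {0..1}" for x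
    using b that by (simp add: bij_betw_def)
  show "f (inv_into {0..1} f x) = x" if "x \<in> {0..1}" for x
    using b that by (simp add: bij_betw_def f_inv_into_f)
  show "f ` {0..1} = {0..1}" using b by (simp add: bij_betw_def)
  show "inv_into {0..1} f ` {0..1} = {0..1}"
    using bij_betw_inv_into[OF b] by (simp add: bij_betw_def)
  show "continuous_on {0..1} f" by (rule Diff1_continuous[OF assms])
  show "continuous_on {0..1} (inv_into {0..1} f)"
    by (rule DERIV_continuous_on[OF has_unit_deriv[OF Diff1_C1_inv[OF assms]]])
qed

text \<open>Away from \<open>e\<close> the chain rule gives the derivative of \<open>f\<close> times
  \<open>\<sigma> (f x) / \<sigma> x\<close>, where \<open>x = k y\<close>. The map \<open>h\<close>
  need not be differentiable at \<open>e\<close>, but this product extends continuously because the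
  ratio tends to \<open>r\<close>, so \<open>h e\<close> and the endpoints are removable.\<close>

lemma conjugate_has_derivative:
  fixes h k \<sigma> f :: "real \<Rightarrow> real" and e r :: real
  defines "R \<equiv> \<lambda>x. if x = e then r else \<sigma> (f x) / \<sigma> x"
  assumes h: "homeomorphism {0..1} {0..1} h k" and mono: "strict_mono_on {0..1} h"
    and e: "e \<in> {0..1}"
    and \<sigma>: "continuous_on ({0..1} - {e}) \<sigma>" "\<And>x. x \<in> {0..1} - {e} \<Longrightarrow> \<sigma> x > 0"
    and hd: "\<And>x. x \<in> {0<..<1} - {e} \<Longrightarrow> (h has_real_derivative \<sigma> x) (at x)"
    and f: "f \<in> Diff1" "f e = e"
    and r: "((\<lambda>x. \<sigma> (f x) / \<sigma> x) \<longlongrightarrow> r) (at e within {0..1})"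
  shows "continuous_on {0..1} (\<lambda>y. unit_deriv f (k y) * R (k y))"
    and "y \<in> {0..1} \<Longrightarrow>
      ((\<lambda>y. h (f (k y))) has_real_derivative unit_deriv f (k y) * R (k y)) (at y within {0..1})"
proof -
  have fe: "f x \<in> {0..1} - {e}" if "x \<in> {0..1} - {e}" for x
  proof -
    have "f x \<noteq> f e"
      using Diff1_bij_betw[OF f(1)] that e by (auto simp: bij_betw_def inj_on_def)
    then show ?thesis using Diff1_mem[OF f(1), of x] f(2) that by auto
  qed
  have q: "continuous_on ({0..1} - {e}) (\<lambda>x. \<sigma> (f x) / \<sigma> x)"
  proof (intro continuous_intros)
    show "continuous_on ({0..1} - {e}) (\<lambda>x. \<sigma> (f x))"
      by (rule continuous_on_compose2[OF \<sigma>(1)])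
        (use fe Diff1_continuous[OF f(1)] continuous_on_subset in \<open>blast+\<close>)
    show "\<forall>x\<in>{0..1} - {e}. \<sigma> x \<noteq> 0" using \<sigma>(2) by fastforce
  qed (rule \<sigma>(1))
  have R: "continuous_on {0..1} R"
    unfolding continuous_on_def
  proof
    fix x :: real assume x: "x \<in> {0..1}"
    show "(R \<longlongrightarrow> R x) (at x within {0..1})"
    proof (cases "x = e")
      case True
      have "\<forall>\<^sub>F u in at e within {0..1}. \<sigma> (f u) / \<sigma> u = R u"
        unfolding eventually_at_filter R_def by (rule always_eventually) auto
      with r have "(R \<longlongrightarrow> r) (at e within {0..1})" by (rule Lim_transform_eventually)
      then show ?thesis using True by (simp add: R_def)
    next
      case False
      have at: "at x within {0..1} = at x within ({0..1} - {e})"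
        by (rule at_within_nhd[where S="- {e}"]) (use False in auto)
      have "((\<lambda>u. \<sigma> (f u) / \<sigma> u) \<longlongrightarrow> \<sigma> (f x) / \<sigma> x) (at x within {0..1} - {e})"
        using q x False by (simp add: continuous_on_def)
      moreover have "\<forall>\<^sub>F u in at x within {0..1} - {e}. \<sigma> (f u) / \<sigma> u = R u"
        unfolding eventually_at_filter R_def by (rule always_eventually) auto
      ultimately have "(R \<longlongrightarrow> \<sigma> (f x) / \<sigma> x) (at x within {0..1} - {e})"
        by (rule Lim_transform_eventually)
      then show ?thesis using False by (simp add: R_def at)
    qed
  qed
  have k: "continuous_on {0..1} k" "k ` {0..1} \<subseteq> {0..1}" and hc: "continuous_on {0..1} h"
    using h by (auto simp: homeomorphism_def)
  show D: "continuous_on {0..1} (\<lambda>y. unit_deriv f (k y) * R (k y))"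
    by (intro continuous_on_mult continuous_on_compose2[OF R k(1) k(2)]
        continuous_on_compose2[OF continuous_on_unit_deriv[OF Diff1_C1[OF f(1)]] k(1) k(2)])
  have F: "continuous_on {0..1} (\<lambda>y. h (f (k y)))"
  proof -
    have "continuous_on {0..1} (\<lambda>y. f (k y))"
      by (rule continuous_on_compose2[OF Diff1_continuous[OF f(1)] k])
    then show ?thesis
      by (rule continuous_on_compose2[OF hc]) (use k(2) Diff1_mem[OF f(1)] in auto)
  qed
  have der: "((\<lambda>y. h (f (k y))) has_real_derivative unit_deriv f (k y) * R (k y)) (at y)"
    if y: "y \<in> {0<..<1} - {h e}" for y
  proof -
    let ?x = "k y"
    have x: "?x \<in> {0<..<1}" using unit_homeo_interior(2)[OF h mono] y by simp
    have xe: "?x \<noteq> e" using unit_homeo_inverse(2)[OF h mono, of y] y by auto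
    have fx: "f ?x \<in> {0<..<1}"
      using unit_homeo_interior(1)[OF Diff1_homeomorphism[OF f(1)] Diff1_strict_mono[OF f(1)] x] .
    have fxe: "f ?x \<noteq> e" using fe[of ?x] x xe by auto
    have "(k has_real_derivative inverse (\<sigma> ?x)) (at y)"
    proof (rule DERIV_inverse_function[where a=0 and b=1])
      show "(h has_real_derivative \<sigma> ?x) (at ?x)" using hd x xe by simp
      show "\<sigma> ?x \<noteq> 0" using \<sigma>(2)[of ?x] x xe by auto
      show "isCont k y"
        using y by (intro continuous_on_interior[OF k(1)]) (auto simp: interior_atLeastAtMost_real)
      show "\<And>u. 0 < u \<Longrightarrow> u < 1 \<Longrightarrow> h (k u) = u"
        using unit_homeo_inverse(2)[OF h mono] by auto
    qed (use y in auto)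
    moreover have "(f has_real_derivative unit_deriv f ?x) (at ?x)"
      using has_unit_deriv[OF Diff1_C1[OF f(1)], of ?x] x at_within_Icc_at[of 0 ?x 1] by auto
    ultimately have "((\<lambda>y. f (k y)) has_real_derivative unit_deriv f ?x * inverse (\<sigma> ?x)) (at y)"
      by (rule DERIV_chain2[rotated])
    moreover have "(h has_real_derivative \<sigma> (f ?x)) (at (f ?x))" using hd fx fxe by simp
    ultimately have "((\<lambda>y. h (f (k y))) has_real_derivative
        \<sigma> (f ?x) * (unit_deriv f ?x * inverse (\<sigma> ?x))) (at y)"
      by (rule DERIV_chain2[rotated])
    then show ?thesis using xe by (simp add: R_def field_simps)
  qed
  show "((\<lambda>y. h (f (k y))) has_real_derivative unit_deriv f (k y) * R (k y)) (at y within {0..1})"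
    if "y \<in> {0..1}"
    by (rule has_derivative_removable_point[OF F D der that])
qed

text \<open>Integrability of the unbounded density \<open>g\<close> at 0 is expressed by a primitive
  \<open>H\<close> that is continuous up to 0, so no integral appears. \<open>H\<close> measures how
  strongly the conjugating map stretches distances from the singular point.\<close>

locale singular_profile =
  fixes H g :: "real \<Rightarrow> real"
  assumes H_zero: "H 0 = 0"
    and H_continuous: "continuous_on {0..} H"
    and H_deriv: "t > 0 \<Longrightarrow> (H has_real_derivative g t) (at t)"
    and g_pos: "t > 0 \<Longrightarrow> g t > 0"
    and g_continuous: "continuous_on {0<..} g"
    and g_at_top: "filterlim g at_top (at_right 0)"
begin

lemma H_mono:
  assumes "0 \<le> s" "s \<le> t"
  shows "H s \<le> H t"
proof (rule DERIV_nonneg_imp_increasing_open[OF assms(2)])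
  fix x assume "s < x"
  then show "\<exists>y. (H has_real_derivative y) (at x) \<and> 0 \<le> y"
    using H_deriv[of x] g_pos[of x] assms(1) by (intro exI[of _ "g x"]) auto
next
  show "continuous_on {s..t} H"
    by (intro continuous_on_subset[OF H_continuous]) (use assms(1) in auto)
qed

text \<open>The map \<open>h\<close> is the normalised primitive of 1 + \<eta> g(|x - e|). Both
  summands of that primitive are increasing, so each alone bounds the increments of \<open>h\<close>
  from below: the identity summand makes \<open>k\<close> Lipschitz, the singular one gives the
  bound by \<open>H\<close> that is played against Lipschitz conjugacies.\<close>

lemma singular_homeo:
  assumes e: "e \<in> {0..1}" and \<eta>: "\<eta> > 0"
  obtains N h k where "N \<ge> 1" "homeomorphism {0..1} {0..1} h k" "strict_mono_on {0..1} h"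
    "\<And>x. x \<in> {0<..<1} - {e} \<Longrightarrow> (h has_real_derivative (1 + \<eta> * g \<bar>x - e\<bar>) / N) (at x)"
    "\<And>x. x \<in> {0..1} \<Longrightarrow> \<bar>h x - x\<bar> \<le> 2 * \<eta> * H 1"
    "\<And>x y. x \<in> {0..1} \<Longrightarrow> y \<in> {0..1} \<Longrightarrow> \<bar>x - y\<bar> \<le> N * \<bar>h x - h y\<bar>"
    "\<And>x. x \<in> {0..1} \<Longrightarrow> \<eta> * H \<bar>x - e\<bar> \<le> N * \<bar>h x - h e\<bar>"
proof -
  \<comment> \<open>\<open>Q\<close> is the primitive of g(|x - e|) that vanishes at
    \<open>e\<close>: \<open>H\<close> of the distance, with a sign.\<close>
  define Q where "Q x = (if x \<le> e then - H (e - x) else H (x - e))" for x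
  have H_nonneg: "H t \<ge> 0" if "t \<ge> 0" for t using H_mono[of 0 t] that H_zero by simp
  have Q_mono: "Q x \<le> Q y" if "x \<le> y" for x y
    using that H_nonneg[of "e - x"] H_nonneg[of "y - e"] H_mono[of "e - y" "e - x"] H_mono[of "x - e" "y - e"]
    by (auto simp: Q_def)
  have Q_abs: "\<bar>Q x - Q e\<bar> = H \<bar>x - e\<bar>" for x
    using H_nonneg[of "\<bar>x - e\<bar>"] H_zero by (auto simp: Q_def abs_minus_commute)
  have Q_cont: "continuous_on {0..1} Q"
    unfolding Q_def
  proof (rule continuous_on_cases_le)
    show "continuous_on {t \<in> {0..1}. t \<le> e} (\<lambda>x. - H (e - x))"
      by (intro continuous_intros continuous_on_compose2[OF H_continuous]) auto
    show "continuous_on {t \<in> {0..1}. e \<le> t} (\<lambda>x. H (x - e))"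
      by (intro continuous_intros continuous_on_compose2[OF H_continuous]) auto
  qed (auto simp: H_zero intro: continuous_intros)
  have Q_deriv: "(Q has_real_derivative g \<bar>x - e\<bar>) (at x)" if "x \<noteq> e" for x
  proof (cases "x < e")
    case True
    have "(H has_real_derivative g (e - x)) (at (e - x))" using H_deriv True by simp
    then have "((\<lambda>x. - H (e - x)) has_real_derivative g \<bar>x - e\<bar>) (at x)"
      using True by (auto intro!: derivative_eq_intros DERIV_chain2[of H])
    then show ?thesis
      by (rule has_field_derivative_transform_within_open[where S="{..<e}"])
        (use True in \<open>auto simp: Q_def\<close>)
  next
    case False
    with that have "x > e" by simp
    then have "(H has_real_derivative g (x - e)) (at (x - e))" using H_deriv by simp
    moreover have "((\<lambda>x. x - e) has_real_derivative 1) (at x)"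
      by (auto intro!: derivative_eq_intros)
    ultimately have "((\<lambda>x. H (x - e)) has_real_derivative g (x - e) * 1) (at x)"
      by (rule DERIV_chain2)
    then have "((\<lambda>x. H (x - e)) has_real_derivative g \<bar>x - e\<bar>) (at x)"
      using \<open>x > e\<close> by simp
    then show ?thesis
      by (rule has_field_derivative_transform_within_open[where S="{e<..}"])
        (use \<open>x > e\<close> in \<open>auto simp: Q_def\<close>)
  qed
  define P where "P x = x + \<eta> * Q x" for x
  define N where "N = P 1 - P 0"
  define h where "h x = (P x - P 0) / N" for x
  have P_diff: "y - x \<le> P y - P x" "\<eta> * (Q y - Q x) \<le> P y - P x" if "x \<le> y" for x y
  proof -
    have "0 \<le> \<eta> * (Q y - Q x)" using \<eta> Q_mono[OF that] by simp
    then show "y - x \<le> P y - P x" "\<eta> * (Q y - Q x) \<le> P y - P x"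
      using that by (auto simp: P_def algebra_simps)
  qed
  have N: "N \<ge> 1" using P_diff(1)[of 0 1] by (simp add: N_def)
  have Nh: "N * (h y - h x) = P y - P x" for x y using N by (simp add: h_def field_simps)
  have mono: "strict_mono_on {0..1} h"
  proof (rule strict_mono_onI)
    fix x y :: real assume "x < y"
    then have "N * (h y - h x) > 0" using P_diff(1)[of x y] Nh[of y x] by linarith
    then show "h x < h y" using N by (simp add: zero_less_mult_iff)
  qed
  have h_cont: "continuous_on {0..1} h"
    unfolding h_def P_def using N by (intro continuous_intros Q_cont) auto
  have h01: "h 0 = 0" "h 1 = 1" using N by (auto simp: h_def N_def)
  have im: "h ` {0..1} = {0..1}"
  proof
    show "h ` {0..1} \<subseteq> {0..1}"
      using strict_mono_on_less_eq[OF mono, of 0] strict_mono_on_less_eq[OF mono, of _ 1] h01 by auto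
    show "{0..1} \<subseteq> h ` {0..1}"
      using IVT'[of h 0 _ 1] h_cont h01 by fastforce
  qed
  obtain k where k: "homeomorphism {0..1} {0..1} h k"
    using homeomorphism_compact[of "{0..1}" h "{0..1}"] h_cont im strict_mono_on_imp_inj_on[OF mono]
    by auto
  \<comment> \<open>As \<open>h\<close> is increasing, N |h x - h y| is the increment of
    \<open>P\<close> taken in the right order.\<close>
  have abs_bound: "b \<le> N * \<bar>h x - h y\<bar>" if "x \<le> y \<Longrightarrow> b \<le> P y - P x" "y \<le> x \<Longrightarrow> b \<le> P x - P y" for b x y
  proof (cases "x \<le> y")
    case True
    have "N * (h y - h x) \<le> N * \<bar>h x - h y\<bar>" using N by (intro mult_left_mono) auto
    then show ?thesis using that(1)[OF True] Nh[of y x] by linarith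
  next
    case False
    have "N * (h x - h y) \<le> N * \<bar>h x - h y\<bar>" using N by (intro mult_left_mono) auto
    then show ?thesis using that(2) False Nh[of x y] by linarith
  qed
  show ?thesis
  proof (rule that[OF N k mono])
    fix x assume "x \<in> {0<..<1} - {e}"
    then show "(h has_real_derivative (1 + \<eta> * g \<bar>x - e\<bar>) / N) (at x)"
      unfolding h_def P_def using N Q_deriv[of x] by (auto intro!: derivative_eq_intros)
  next
    fix x :: real assume x: "x \<in> {0..1}"
    have "Q 0 \<le> Q x" "Q x \<le> Q 1" using Q_mono x by auto
    \<comment> \<open>Both endpoints are within 1 of \<open>e\<close>, so \<open>Q\<close> varies by
      at most 2 H(1). Then N (h x - x) is \<eta> times a difference of two numbers in [0, 2 H(1)],
      and N \<ge> 1.\<close>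
    have "\<bar>Q 1 - Q e\<bar> \<le> H 1" "\<bar>Q 0 - Q e\<bar> \<le> H 1"
      unfolding Q_abs using H_mono[of "\<bar>1 - e\<bar>" 1] H_mono[of "\<bar>0 - e\<bar>" 1] e by auto
    then have Q01: "Q 1 - Q 0 \<le> 2 * H 1" by linarith
    have eq: "N * (h x - x) = \<eta> * ((Q x - Q 0) - x * (Q 1 - Q 0))"
      using N by (simp add: h_def N_def P_def field_simps)
    have "0 \<le> x * (Q 1 - Q 0)" "x * (Q 1 - Q 0) \<le> Q 1 - Q 0"
      using x Q_mono[of 0 1] by (auto intro: mult_left_le_one_le)
    then have "\<bar>(Q x - Q 0) - x * (Q 1 - Q 0)\<bar> \<le> 2 * H 1"
      using Q01 \<open>Q 0 \<le> Q x\<close> \<open>Q x \<le> Q 1\<close> by linarith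
    then have "\<bar>N * (h x - x)\<bar> \<le> \<eta> * (2 * H 1)"
      unfolding eq abs_mult using \<eta> by simp
    moreover have "\<bar>h x - x\<bar> \<le> \<bar>N * (h x - x)\<bar>"
      using N by (simp add: abs_mult mult_le_cancel_right1)
    ultimately show "\<bar>h x - x\<bar> \<le> 2 * \<eta> * H 1" by simp
  next
    show "\<bar>x - y\<bar> \<le> N * \<bar>h x - h y\<bar>" for x y
      by (rule abs_bound) (use P_diff(1)[of x y] P_diff(1)[of y x] in auto)
    show "\<eta> * H \<bar>x - e\<bar> \<le> N * \<bar>h x - h e\<bar>" for x
      unfolding Q_abs[symmetric]
      by (rule abs_bound) (use P_diff(2)[of x e] P_diff(2)[of e x] Q_mono[of x e] Q_mono[of e x] in auto)
  qed
qed

text \<open>Dividing numerator and denominator by g(|x - e|), which tends to infinity, leaves terms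
  tending to \<eta> r and \<eta>. The limit is therefore the same for every \<eta>.\<close>

lemma perturbed_ratio_tendsto:
  assumes \<eta>: "\<eta> > 0" and e: "e \<in> {0..1}"
    and f: "f \<in> Diff1" "f e = e"
    and lim: "((\<lambda>x. g \<bar>f x - e\<bar> / g \<bar>x - e\<bar>) \<longlongrightarrow> r) (at e within {0..1})"
  shows "((\<lambda>x. (1 + \<eta> * g \<bar>f x - e\<bar>) / (1 + \<eta> * g \<bar>x - e\<bar>)) \<longlongrightarrow> r) (at e within {0..1})"
proof -
  have "filterlim (\<lambda>x. \<bar>x - e\<bar>) (at_right 0) (at e within {0..1})"
    unfolding filterlim_at
  proof
    have "((\<lambda>x. \<bar>x - e\<bar>) \<longlongrightarrow> \<bar>e - e\<bar>) (at e within {0..1})" by (intro tendsto_intros)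
    then show "((\<lambda>x. \<bar>x - e\<bar>) \<longlongrightarrow> 0) (at e within {0..1})" by simp
  qed (auto simp: eventually_at_filter)
  from filterlim_compose[OF g_at_top this]
  have "((\<lambda>x. inverse (g \<bar>x - e\<bar>)) \<longlongrightarrow> 0) (at e within {0..1})"
    by (rule tendsto_inverse_0_at_top)
  from tendsto_divide[OF tendsto_add[OF this tendsto_mult[OF tendsto_const lim]]
      tendsto_add[OF this tendsto_const], of \<eta> \<eta>]
  have "((\<lambda>x. (inverse (g \<bar>x - e\<bar>) + \<eta> * (g \<bar>f x - e\<bar> / g \<bar>x - e\<bar>))
      / (inverse (g \<bar>x - e\<bar>) + \<eta>)) \<longlongrightarrow> r) (at e within {0..1})"
    using \<eta> by simp
  moreover have "\<forall>\<^sub>F x in at e within {0..1}.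
      (inverse (g \<bar>x - e\<bar>) + \<eta> * (g \<bar>f x - e\<bar> / g \<bar>x - e\<bar>)) / (inverse (g \<bar>x - e\<bar>) + \<eta>)
      = (1 + \<eta> * g \<bar>f x - e\<bar>) / (1 + \<eta> * g \<bar>x - e\<bar>)"
    unfolding eventually_at_filter
  proof (rule always_eventually, intro allI impI)
    fix x assume "x \<noteq> e"
    then have g0: "g \<bar>x - e\<bar> > 0" by (intro g_pos) auto
    have "inverse G + \<eta> * (G' / G) = (1 + \<eta> * G') / G \<and> inverse G + \<eta> = (1 + \<eta> * G) / G"
      if "G > 0" for G G' :: real using that by (simp add: field_simps)
    from this[OF g0, of "g \<bar>f x - e\<bar>"] g0
    show "(inverse (g \<bar>x - e\<bar>) + \<eta> * (g \<bar>f x - e\<bar> / g \<bar>x - e\<bar>)) / (inverse (g \<bar>x - e\<bar>) + \<eta>)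
      = (1 + \<eta> * g \<bar>f x - e\<bar>) / (1 + \<eta> * g \<bar>x - e\<bar>)" by simp
  qed
  ultimately show ?thesis by (rule Lim_transform_eventually)
qed

text \<open>Two regimes make the bound uniform in x. Near \<open>e\<close> the ratio of the values
  of \<open>g\<close> is within \<epsilon> of 1, and adding 1 to \<eta> times both values only
  brings it closer to 1, for every \<eta>. On the compact remainder the difference of the two values
  is bounded by some \<open>B\<close>, and \<eta> < \<epsilon> / B suffices.\<close>

lemma perturbed_ratio_near_1:
  assumes e: "e \<in> {0..1}" and f: "f \<in> Diff1" "f e = e"
    and lim: "((\<lambda>x. g \<bar>f x - e\<bar> / g \<bar>x - e\<bar>) \<longlongrightarrow> r) (at e within {0..1})"
    and r: "\<bar>r - 1\<bar> < \<epsilon>"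
  shows "\<forall>\<^sub>F \<eta> in at_right 0. \<forall>x\<in>{0..1} - {e}.
    \<bar>(1 + \<eta> * g \<bar>f x - e\<bar>) / (1 + \<eta> * g \<bar>x - e\<bar>) - 1\<bar> \<le> \<epsilon>"
proof -
  have \<epsilon>: "\<epsilon> > 0" using r by linarith
  have "((\<lambda>x. \<bar>g \<bar>f x - e\<bar> / g \<bar>x - e\<bar> - 1\<bar>) \<longlongrightarrow> \<bar>r - 1\<bar>) (at e within {0..1})"
    by (intro tendsto_intros lim)
  from order_tendstoD(2)[OF this r] obtain d where d: "d > 0"
    "\<And>x. x \<in> {0..1} \<Longrightarrow> x \<noteq> e \<Longrightarrow> \<bar>x - e\<bar> < d \<Longrightarrow> \<bar>g \<bar>f x - e\<bar> / g \<bar>x - e\<bar> - 1\<bar> < \<epsilon>"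
    by (auto simp: eventually_at dist_real_def)
  define K where "K = {0..1} - ball e d"
  have fne: "f x \<noteq> e" if "x \<in> {0..1}" "x \<noteq> e" for x
    using Diff1_bij_betw[OF f(1)] that e f(2) by (auto simp: bij_betw_def inj_on_def)
  have K: "x \<in> {0..1}" "x \<noteq> e" "f x \<noteq> e" if "x \<in> K" for x
  proof -
    show "x \<in> {0..1}" "x \<noteq> e" using that d(1) by (auto simp: K_def)
    then show "f x \<noteq> e" by (rule fne)
  qed
  have "continuous_on K (\<lambda>x. g \<bar>f x - e\<bar> - g \<bar>x - e\<bar>)"
  proof (intro continuous_on_diff continuous_on_compose2[OF g_continuous] continuous_intros)
    show "continuous_on K f"
      by (rule continuous_on_subset[OF Diff1_continuous[OF f(1)]]) (auto simp: K_def)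
  qed (use K in auto)
  moreover have "compact K" unfolding K_def by (intro compact_diff) auto
  ultimately have "bounded ((\<lambda>x. g \<bar>f x - e\<bar> - g \<bar>x - e\<bar>) ` K)"
    using compact_continuous_image compact_imp_bounded by blast
  then obtain B where B: "B > 0" "\<And>x. x \<in> K \<Longrightarrow> \<bar>g \<bar>f x - e\<bar> - g \<bar>x - e\<bar>\<bar> \<le> B"
    unfolding bounded_pos by auto
  have bound: "\<bar>(1 + \<eta> * g \<bar>f x - e\<bar>) / (1 + \<eta> * g \<bar>x - e\<bar>) - 1\<bar> \<le> \<epsilon>"
    if \<eta>: "0 < \<eta>" "\<eta> < \<epsilon> / B" and x: "x \<in> {0..1} - {e}" for \<eta> x
  proof -
    let ?G = "g \<bar>x - e\<bar>" and ?G' = "g \<bar>f x - e\<bar>"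
    have G: "?G > 0" using x by (intro g_pos) auto
    have pos: "1 + \<eta> * ?G > 0" using \<eta> G by (simp add: add_pos_pos)
    have "(1 + \<eta> * ?G') / (1 + \<eta> * ?G) - 1 = \<eta> * (?G' - ?G) / (1 + \<eta> * ?G)"
      using pos by (simp add: field_simps)
    then have eq: "\<bar>(1 + \<eta> * ?G') / (1 + \<eta> * ?G) - 1\<bar> = \<eta> * \<bar>?G' - ?G\<bar> / (1 + \<eta> * ?G)"
      using pos \<eta> by (simp add: abs_mult)
    have "\<eta> * \<bar>?G' - ?G\<bar> \<le> \<epsilon> * (1 + \<eta> * ?G)"
    proof (cases "\<bar>x - e\<bar> < d")
      case True
      have "?G' / ?G - 1 = (?G' - ?G) / ?G" using G by (simp add: field_simps)
      with d(2)[of x] x True have "\<bar>(?G' - ?G) / ?G\<bar> < \<epsilon>" by simp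
      then have "\<bar>?G' - ?G\<bar> \<le> \<epsilon> * ?G" using G by (simp add: abs_divide field_simps)
      then have "\<eta> * \<bar>?G' - ?G\<bar> \<le> \<eta> * (\<epsilon> * ?G)" using \<eta> by (intro mult_left_mono) auto
      then show ?thesis using \<epsilon> by (simp add: algebra_simps)
    next
      case False
      then have "x \<in> K" using x by (auto simp: K_def dist_real_def abs_minus_commute)
      then have "\<eta> * \<bar>?G' - ?G\<bar> \<le> \<eta> * B" using B(2) \<eta> by (intro mult_left_mono) auto
      also have "\<dots> \<le> \<epsilon>" using \<eta> B(1) by (simp add: field_simps)
      also have "\<dots> \<le> \<epsilon> * (1 + \<eta> * ?G)" using \<epsilon> \<eta> G by simp
      finally show ?thesis .
    qed
    then show ?thesis unfolding eq using pos by (simp add: pos_divide_le_eq)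
  qed
  have "\<forall>\<^sub>F \<eta> in at_right 0. \<eta> \<in> {0<..<\<epsilon> / B}"
    by (rule eventually_at_right_real) (use \<epsilon> B(1) in simp)
  then show ?thesis
  proof (rule eventually_mono, intro ballI)
    fix \<eta> x assume "\<eta> \<in> {0<..<\<epsilon> / B}" "x \<in> {0..1} - {e}"
    then show "\<bar>(1 + \<eta> * g \<bar>f x - e\<bar>) / (1 + \<eta> * g \<bar>x - e\<bar>) - 1\<bar> \<le> \<epsilon>"
      by (intro bound) auto
  qed
qed

end

section \<open>Actions on the unit interval\<close>

locale interval_action = group G for G :: "('g, 'b) monoid_scheme" (structure) +
  fixes \<phi> :: "'g \<Rightarrow> real \<Rightarrow> real"
  assumes action: "C1_action G \<phi>"
begin

lemma action_Diff1: "g \<in> carrier G \<Longrightarrow> \<phi> g \<in> Diff1"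
  using action by (auto simp: C1_action_def hom_def Diff1_group_def)

lemma action_mem: "g \<in> carrier G \<Longrightarrow> x \<in> {0..1} \<Longrightarrow> \<phi> g x \<in> {0..1}"
  by (rule Diff1_mem[OF action_Diff1])

lemma action_mult:
  assumes "a \<in> carrier G" "b \<in> carrier G" "x \<in> {0..1}"
  shows "\<phi> (a \<otimes> b) x = \<phi> a (\<phi> b x)"
proof -
  have "\<phi> (a \<otimes> b) = compose {0..1} (\<phi> a) (\<phi> b)"
    using action assms Diff1_Bij[OF action_Diff1]
    by (auto simp: C1_action_def hom_def Diff1_group_def BijGroup_def)
  then show ?thesis using assms(3) by (simp add: compose_def)
qed

lemma action_one: "x \<in> {0..1} \<Longrightarrow> \<phi> \<one> x = x"
proof -
  assume x: "x \<in> {0..1}"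
  \<comment> \<open>An idempotent injective map is the identity.\<close>
  have "\<phi> \<one> (\<phi> \<one> x) = \<phi> \<one> x" using action_mult[of \<one> \<one> x] x by simp
  then show ?thesis
    using Diff1_bij_betw[OF action_Diff1[of \<one>]] action_mem[of \<one> x] x
    by (auto simp: bij_betw_def inj_on_def)
qed

lemma action_inv:
  assumes "a \<in> carrier G" "x \<in> {0..1}"
  shows "\<phi> (inv a) (\<phi> a x) = x" "\<phi> a (\<phi> (inv a) x) = x"
  using action_mult[of "inv a" a x] action_mult[of a "inv a" x] action_one[of x] assms by auto

lemma action_less:
  "g \<in> carrier G \<Longrightarrow> x \<in> {0..1} \<Longrightarrow> y \<in> {0..1} \<Longrightarrow> \<phi> g x < \<phi> g y \<longleftrightarrow> x < y"
  by (rule Diff1_less[OF action_Diff1])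

lemma action_le:
  "g \<in> carrier G \<Longrightarrow> x \<in> {0..1} \<Longrightarrow> y \<in> {0..1} \<Longrightarrow> \<phi> g x \<le> \<phi> g y \<longleftrightarrow> x \<le> y"
  by (rule Diff1_le[OF action_Diff1])

text \<open>The conjugates are restricted because elements of \<open>Bij {0..1}\<close> are
  extensional. Assuming C^1 for all group elements at once covers the inverses, since the conjugate
  of \<open>inv a\<close> inverts that of \<open>a\<close>.\<close>

lemma restrict_conjugate_action:
  assumes h: "homeomorphism {0..1} {0..1} h k" and mono: "strict_mono_on {0..1} h"
    and C1: "\<And>g. g \<in> carrier G \<Longrightarrow> C1_on_unit (\<lambda>y. h (\<phi> g (k y)))"
  shows "C1_action G (\<lambda>g. restrict (\<lambda>y. h (\<phi> g (k y))) {0..1})"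
proof -
  let ?\<psi> = "\<lambda>g. restrict (\<lambda>y. h (\<phi> g (k y))) {0..1}"
  note hk = unit_homeo_mem[OF h mono] unit_homeo_inverse[OF h mono]
  have mem: "?\<psi> g y \<in> {0..1}" if "g \<in> carrier G" "y \<in> {0..1}" for g y
    using hk(1)[OF action_mem[OF that(1) hk(2)[OF that(2)]]] that(2) by simp
  have mult: "?\<psi> (a \<otimes> b) y = ?\<psi> a (?\<psi> b y)"
    if "a \<in> carrier G" "b \<in> carrier G" "y \<in> {0..1}" for a b y
  proof -
    have "k (h (\<phi> b (k y))) = \<phi> b (k y)"
      by (rule hk(3)[OF action_mem[OF that(2) hk(2)[OF that(3)]]])
    then show ?thesis
      using mem[OF that(2,3)] action_mult[OF that(1,2) hk(2)[OF that(3)]] that(3) by simp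
  qed
  have one: "?\<psi> \<one> y = y" if "y \<in> {0..1}" for y
    using that action_one[OF hk(2)[OF that]] hk(4)[OF that] by simp
  have inv1: "?\<psi> (inv a) (?\<psi> a y) = y" if "a \<in> carrier G" "y \<in> {0..1}" for a y
    using mult[of "inv a" a y] one that by simp
  have inv2: "?\<psi> a (?\<psi> (inv a) y) = y" if "a \<in> carrier G" "y \<in> {0..1}" for a y
    using mult[of a "inv a" y] one that by simp
  have bij: "bij_betw (?\<psi> a) {0..1} {0..1}" if "a \<in> carrier G" for a
  proof (rule bij_betw_byWitness[where f'="?\<psi> (inv a)"])
    show "\<forall>y\<in>{0..1}. ?\<psi> (inv a) (?\<psi> a y) = y" by (intro ballI inv1[OF that])
    show "\<forall>y\<in>{0..1}. ?\<psi> a (?\<psi> (inv a) y) = y" by (intro ballI inv2[OF that])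
    show "?\<psi> a ` {0..1} \<subseteq> {0..1}" by (intro image_subsetI mem[OF that])
    show "?\<psi> (inv a) ` {0..1} \<subseteq> {0..1}" by (intro image_subsetI mem[OF inv_closed[OF that]])
  qed
  have Bij: "?\<psi> a \<in> Bij {0..1}" if "a \<in> carrier G" for a
    unfolding Bij_def using bij[OF that] by (simp add: restrict_extensional)
  have C1': "C1_on_unit (?\<psi> a)" if "a \<in> carrier G" for a
    by (rule C1_on_unit_cong[OF C1[OF that]]) simp
  have "?\<psi> a \<in> Diff1" if a: "a \<in> carrier G" for a
    unfolding Diff1_def
  proof (intro CollectI conjI)
    show "?\<psi> a \<in> Bij {0..1}" "C1_on_unit (?\<psi> a)" using Bij C1' a by auto
    show "C1_on_unit (inv_into {0..1} (?\<psi> a))"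
    proof (rule C1_on_unit_cong[OF C1'[OF inv_closed[OF a]]])
      fix y :: real assume y: "y \<in> {0..1}"
      show "?\<psi> (inv a) y = inv_into {0..1} (?\<psi> a) y"
        by (rule inv_into_f_eq[symmetric, OF bij_betw_imp_inj_on[OF bij[OF a]]
              mem[OF inv_closed[OF a] y] inv2[OF a y]])
    qed
    show "strict_mono_on {0..1} (?\<psi> a)"
    proof (rule strict_mono_onI)
      fix x y :: real assume xy: "x \<in> {0..1}" "y \<in> {0..1}" "x < y"
      have "k x < k y" by (rule strict_mono_onD[OF unit_homeo_inverse_mono[OF h mono] xy])
      then have "\<phi> a (k x) < \<phi> a (k y)" using action_less[OF a hk(2)[OF xy(1)] hk(2)[OF xy(2)]] by simp
      then show "?\<psi> a x < ?\<psi> a y"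
        using strict_mono_onD[OF mono action_mem[OF a hk(2)[OF xy(1)]] action_mem[OF a hk(2)[OF xy(2)]]] xy
        by simp
    qed
  qed
  moreover have "?\<psi> (a \<otimes> b) = ?\<psi> a \<otimes>\<^bsub>Diff1_group\<^esub> ?\<psi> b" if "a \<in> carrier G" "b \<in> carrier G" for a b
  proof -
    have "?\<psi> (a \<otimes> b) = compose {0..1} (?\<psi> a) (?\<psi> b)"
      by (rule extensionalityI[where A="{0..1}"])
        (use mult that in \<open>auto simp: compose_def\<close>)
    then show ?thesis using Bij that by (simp add: Diff1_group_def BijGroup_def)
  qed
  ultimately show ?thesis
    unfolding C1_action_def hom_def by (auto simp: Diff1_group_def)
qed

section \<open>Conjugacies and the centralizer of an action\<close>

definition commuting_homeo :: "(real \<Rightarrow> real) \<Rightarrow> (real \<Rightarrow> real) \<Rightarrow> bool" where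
  "commuting_homeo c c' \<longleftrightarrow> homeomorphism {0..1} {0..1} c c' \<and>
     (\<forall>g\<in>carrier G. \<forall>x\<in>{0..1}. c (\<phi> g x) = \<phi> g (c x))"

text \<open>Two conjugacies onto the same action differ by a homeomorphism commuting with the
  original action: here \<psi> is \<open>h\<close> after \<open>c\<close>, where \<open>c\<close> is
  \<open>k\<close> after \<psi>. Like \<psi>, the map \<open>c\<close> may reverse
  orientation.\<close>

lemma conjugacy_imp_commuting_homeo:
  assumes h: "homeomorphism {0..1} {0..1} h k" and mono: "strict_mono_on {0..1} h"
    and \<psi>: "conjugacy G \<phi> (\<lambda>g. restrict (\<lambda>y. h (\<phi> g (k y))) {0..1}) \<psi>"
  obtains c' where "commuting_homeo (\<lambda>x. k (\<psi> x)) c'" "\<And>x. x \<in> {0..1} \<Longrightarrow> h (k (\<psi> x)) = \<psi> x"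
proof -
  obtain \<xi> where \<xi>: "homeomorphism {0..1} {0..1} \<psi> \<xi>"
    and conj: "\<And>g x. g \<in> carrier G \<Longrightarrow> x \<in> {0..1} \<Longrightarrow> h (\<phi> g (k x)) = \<psi> (\<phi> g (\<xi> x))"
    using \<psi> by (auto simp: conjugacy_def)
  note hk = unit_homeo_mem[OF h mono] unit_homeo_inverse[OF h mono]
  have \<psi>_mem: "\<psi> x \<in> {0..1}" and \<xi>\<psi>: "\<xi> (\<psi> x) = x" if "x \<in> {0..1}" for x
    using \<xi> that unfolding homeomorphism_def by blast+
  have "k (\<psi> (\<phi> g x)) = \<phi> g (k (\<psi> x))" if "g \<in> carrier G" "x \<in> {0..1}" for g x
    using conj[OF that(1) \<psi>_mem[OF that(2)]] \<xi>\<psi>[OF that(2)]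
      hk(3)[OF action_mem[OF that(1) hk(2)[OF \<psi>_mem[OF that(2)]]]] by simp
  moreover have "homeomorphism {0..1} {0..1} (k \<circ> \<psi>) (\<xi> \<circ> h)"
    by (rule homeomorphism_compose[OF \<xi> homeomorphism_symD[OF h]])
  ultimately have "commuting_homeo (\<lambda>x. k (\<psi> x)) (\<xi> \<circ> h)"
    by (auto simp: commuting_homeo_def o_def)
  then show ?thesis using that hk(4)[OF \<psi>_mem] by blast
qed

text \<open>This criterion separates the perturbation from the choice of the profile. The limits
  \<open>r a\<close> for all group elements make the conjugates C^1, their closeness to 1 on
  \<open>S\<close> makes the new action close to \<phi>, and \<open>no_centralizer\<close> excludes
  Lipschitz conjugacies: if \<open>h\<close> after \<open>c\<close> is Lipschitz, the two lower
  bounds on increments of \<open>h\<close> become upper bounds for \<open>c\<close>.\<close>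

lemma singular_approximation:
  assumes "singular_profile H g"
    and e: "e \<in> {0..1}" "\<And>a. a \<in> carrier G \<Longrightarrow> \<phi> a e = e"
    and lim: "\<And>a. a \<in> carrier G \<Longrightarrow>
      ((\<lambda>x. g \<bar>\<phi> a x - e\<bar> / g \<bar>x - e\<bar>) \<longlongrightarrow> r a) (at e within {0..1})"
    and S: "finite S" "S \<subseteq> carrier G"
    and \<epsilon>: "\<epsilon> > 0"
    and near: "\<And>s x. s \<in> S \<Longrightarrow> x \<in> {0..1} \<Longrightarrow> unit_deriv (\<phi> s) x * \<epsilon>' \<le> \<epsilon> / 4"
      "\<And>s. s \<in> S \<Longrightarrow> \<bar>r s - 1\<bar> < \<epsilon>'"
    and no_centralizer: "\<And>c c' L. commuting_homeo c c' \<Longrightarrow>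
      (\<And>x y. x \<in> {0..1} \<Longrightarrow> y \<in> {0..1} \<Longrightarrow> \<bar>c x - c y\<bar> \<le> L * \<bar>x - y\<bar>) \<Longrightarrow>
      (\<And>x. x \<in> {0..1} \<Longrightarrow> H \<bar>c x - e\<bar> \<le> L * \<bar>x - c' e\<bar>) \<Longrightarrow> False"
  shows "\<exists>\<phi>'. C1_action G \<phi>' \<and> (topologically_conjugate G \<phi> \<phi>' \<and> \<not> Lipschitz_conjugate G \<phi> \<phi>') \<and>
    (\<forall>s\<in>S. C1_norm (\<lambda>x. \<phi>' s x - \<phi> s x) \<le> \<epsilon>)"
proof -
  interpret singular_profile H g by fact
  have tiny: "\<forall>\<^sub>F \<eta> in at_right 0. 2 * \<eta> * H 1 < d" if "d > 0" for d
  proof -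
    have "((\<lambda>\<eta>. 2 * \<eta> * H 1) \<longlongrightarrow> 2 * 0 * H 1) (at_right 0)" by (intro tendsto_intros)
    from order_tendstoD(2)[OF this, of d] that show ?thesis by simp
  qed
  have "\<exists>d>0. \<forall>x\<in>{0..1}. \<forall>y\<in>{0..1}. \<bar>x - y\<bar> < d \<longrightarrow>
      \<bar>\<phi> s x - \<phi> s y\<bar> < \<epsilon> / 4 \<and> \<bar>unit_deriv (\<phi> s) x - unit_deriv (\<phi> s) y\<bar> < \<epsilon> / 4" if "s \<in> S" for s
  proof -
    have D: "\<phi> s \<in> Diff1" by (rule action_Diff1[OF subsetD[OF S(2) that]])
    have \<epsilon>4: "\<epsilon> / 4 > 0" using \<epsilon> by simp
    have u: "uniformly_continuous_on {0..1} (\<phi> s)" "uniformly_continuous_on {0..1} (unit_deriv (\<phi> s))"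
      by (intro compact_uniformly_continuous compact_Icc Diff1_continuous[OF D]
          continuous_on_unit_deriv[OF Diff1_C1[OF D]])+
    from u(1)[unfolded uniformly_continuous_on_def, THEN spec, THEN mp, OF \<epsilon>4]
    obtain d1 where d1: "d1 > 0"
        "\<forall>x\<in>{0..1}. \<forall>y\<in>{0..1}. dist y x < d1 \<longrightarrow> dist (\<phi> s y) (\<phi> s x) < \<epsilon> / 4"
      by blast
    from u(2)[unfolded uniformly_continuous_on_def, THEN spec, THEN mp, OF \<epsilon>4]
    obtain d2 where d2: "d2 > 0"
        "\<forall>x\<in>{0..1}. \<forall>y\<in>{0..1}. dist y x < d2 \<longrightarrow>
          dist (unit_deriv (\<phi> s) y) (unit_deriv (\<phi> s) x) < \<epsilon> / 4"
      by blast
    show ?thesis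
    proof (intro exI[of _ "min d1 d2"] conjI ballI impI)
      fix x y :: real assume xy: "x \<in> {0..1}" "y \<in> {0..1}" "\<bar>x - y\<bar> < min d1 d2"
      show "\<bar>\<phi> s x - \<phi> s y\<bar> < \<epsilon> / 4"
        using d1(2)[rule_format, OF xy(2,1)] xy(3) by (simp add: dist_real_def)
      show "\<bar>unit_deriv (\<phi> s) x - unit_deriv (\<phi> s) y\<bar> < \<epsilon> / 4"
        using d2(2)[rule_format, OF xy(2,1)] xy(3) by (simp add: dist_real_def)
    qed (use d1(1) d2(1) in simp)
  qed
  then obtain d where d: "\<And>s. s \<in> S \<Longrightarrow> d s > 0"
    "\<And>s x y. s \<in> S \<Longrightarrow> x \<in> {0..1} \<Longrightarrow> y \<in> {0..1} \<Longrightarrow> \<bar>x - y\<bar> < d s \<Longrightarrow>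
      \<bar>\<phi> s x - \<phi> s y\<bar> < \<epsilon> / 4 \<and> \<bar>unit_deriv (\<phi> s) x - unit_deriv (\<phi> s) y\<bar> < \<epsilon> / 4"
    by metis
  have "\<forall>\<^sub>F \<eta> in at_right 0. \<forall>s\<in>S. 2 * \<eta> * H 1 < d s"
    by (intro eventually_ball_finite S(1) ballI tiny d(1))
  moreover have "\<forall>\<^sub>F \<eta> in at_right 0. \<forall>s\<in>S. \<forall>x\<in>{0..1} - {e}.
      \<bar>(1 + \<eta> * g \<bar>\<phi> s x - e\<bar>) / (1 + \<eta> * g \<bar>x - e\<bar>) - 1\<bar> \<le> \<epsilon>'"
  proof (rule eventually_ball_finite[OF S(1)], rule ballI)
    fix s assume s: "s \<in> S"
    then have a: "s \<in> carrier G" by (rule subsetD[OF S(2)])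
    show "\<forall>\<^sub>F \<eta> in at_right 0. \<forall>x\<in>{0..1} - {e}.
        \<bar>(1 + \<eta> * g \<bar>\<phi> s x - e\<bar>) / (1 + \<eta> * g \<bar>x - e\<bar>) - 1\<bar> \<le> \<epsilon>'"
      by (rule perturbed_ratio_near_1[OF e(1) action_Diff1[OF a] e(2)[OF a] lim[OF a] near(2)[OF s]])
  qed
  moreover have "\<forall>\<^sub>F \<eta> in at_right 0. 2 * \<eta> * H 1 < \<epsilon> / 4" by (rule tiny) (use \<epsilon> in simp)
  moreover have "\<forall>\<^sub>F \<eta> in at_right 0. (0::real) < \<eta>" by (rule eventually_at_right_less)
  ultimately have "\<forall>\<^sub>F \<eta> in at_right 0. (\<forall>s\<in>S. 2 * \<eta> * H 1 < d s) \<and>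
      (\<forall>s\<in>S. \<forall>x\<in>{0..1} - {e}.
        \<bar>(1 + \<eta> * g \<bar>\<phi> s x - e\<bar>) / (1 + \<eta> * g \<bar>x - e\<bar>) - 1\<bar> \<le> \<epsilon>') \<and>
      2 * \<eta> * H 1 < \<epsilon> / 4 \<and> 0 < \<eta>"
    by eventually_elim blast
  \<comment> \<open>One small \<eta> meets all demands: \<open>h\<close> moves points by less than
    every continuity modulus \<open>d s\<close> and by less than \<epsilon> / 4, and the density
    ratios of the elements of \<open>S\<close> stay within \<epsilon>' of 1.\<close>
  from eventually_happens'[OF trivial_limit_at_right_real this] obtain \<eta> where \<eta>_d: "\<And>s. s \<in> S \<Longrightarrow> 2 * \<eta> * H 1 < d s"
    and \<eta>_R: "\<And>s x. s \<in> S \<Longrightarrow> x \<in> {0..1} - {e} \<Longrightarrow>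
        \<bar>(1 + \<eta> * g \<bar>\<phi> s x - e\<bar>) / (1 + \<eta> * g \<bar>x - e\<bar>) - 1\<bar> \<le> \<epsilon>'"
    and \<eta>_\<epsilon>: "2 * \<eta> * H 1 < \<epsilon> / 4" and \<eta>: "\<eta> > 0"
    by blast
  obtain N h k where N: "N \<ge> 1" and h: "homeomorphism {0..1} {0..1} h k" and mono: "strict_mono_on {0..1} h"
    and hd: "\<And>x. x \<in> {0<..<1} - {e} \<Longrightarrow> (h has_real_derivative (1 + \<eta> * g \<bar>x - e\<bar>) / N) (at x)"
    and h_id: "\<And>x. x \<in> {0..1} \<Longrightarrow> \<bar>h x - x\<bar> \<le> 2 * \<eta> * H 1"
    and h_expand: "\<And>x y. x \<in> {0..1} \<Longrightarrow> y \<in> {0..1} \<Longrightarrow> \<bar>x - y\<bar> \<le> N * \<bar>h x - h y\<bar>"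
    and h_H: "\<And>x. x \<in> {0..1} \<Longrightarrow> \<eta> * H \<bar>x - e\<bar> \<le> N * \<bar>h x - h e\<bar>"
    by (rule singular_homeo[OF e(1) \<eta>]) blast
  note hk = unit_homeo_mem[OF h mono] unit_homeo_inverse[OF h mono]
  define \<sigma> where "\<sigma> x = (1 + \<eta> * g \<bar>x - e\<bar>) / N" for x
  define R where "R s x = (if x = e then r s else \<sigma> (\<phi> s x) / \<sigma> x)" for s x
  have \<sigma>_pos: "\<sigma> x > 0" if "x \<in> {0..1} - {e}" for x
    using g_pos[of "\<bar>x - e\<bar>"] that \<eta> N by (auto simp: \<sigma>_def add_pos_pos)
  have \<sigma>_cont: "continuous_on ({0..1} - {e}) \<sigma>"
    unfolding \<sigma>_def using N
    by (intro continuous_intros continuous_on_compose2[OF g_continuous]) auto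
  have \<sigma>_ratio: "\<sigma> y / \<sigma> x = (1 + \<eta> * g \<bar>y - e\<bar>) / (1 + \<eta> * g \<bar>x - e\<bar>)" for x y
    using N by (simp add: \<sigma>_def)
  have deriv: "continuous_on {0..1} (\<lambda>y. unit_deriv (\<phi> a) (k y) * R a (k y))"
      "\<And>y. y \<in> {0..1} \<Longrightarrow> ((\<lambda>y. h (\<phi> a (k y))) has_real_derivative unit_deriv (\<phi> a) (k y) * R a (k y))
        (at y within {0..1})" if a: "a \<in> carrier G" for a
  proof -
    have "((\<lambda>x. \<sigma> (\<phi> a x) / \<sigma> x) \<longlongrightarrow> r a) (at e within {0..1})"
      unfolding \<sigma>_ratio
      by (rule perturbed_ratio_tendsto[OF \<eta> e(1) action_Diff1[OF a] e(2)[OF a] lim[OF a]])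
    note D = conjugate_has_derivative[OF h mono e(1) \<sigma>_cont \<sigma>_pos hd[folded \<sigma>_def]
        action_Diff1[OF a] e(2)[OF a] this, folded R_def]
    show "continuous_on {0..1} (\<lambda>y. unit_deriv (\<phi> a) (k y) * R a (k y))" by (rule D(1))
    show "((\<lambda>y. h (\<phi> a (k y))) has_real_derivative unit_deriv (\<phi> a) (k y) * R a (k y))
        (at y within {0..1})" if "y \<in> {0..1}" for y by (rule D(2)[OF _ _ that])
  qed
  define \<psi> where "\<psi> = (\<lambda>a. restrict (\<lambda>y. h (\<phi> a (k y))) {0..1})"
  have act: "C1_action G \<psi>"
    unfolding \<psi>_def
  proof (rule restrict_conjugate_action[OF h mono])
    show "C1_on_unit (\<lambda>y. h (\<phi> a (k y)))" if "a \<in> carrier G" for a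
      unfolding C1_on_unit_def using deriv[OF that] by blast
  qed
  have "conjugacy G \<phi> \<psi> h"
    unfolding conjugacy_def \<psi>_def using h by (intro exI[of _ k]) auto
  then have top: "topologically_conjugate G \<phi> \<psi>" by (auto simp: topologically_conjugate_def)
  have "\<not> Lipschitz_conjugate G \<phi> \<psi>"
  proof
    assume "Lipschitz_conjugate G \<phi> \<psi>"
    then obtain \<omega> L where \<omega>: "conjugacy G \<phi> \<psi> \<omega>" and L: "L-lipschitz_on {0..1} \<omega>"
      by (auto simp: Lipschitz_conjugate_def)
    define c where "c x = k (\<omega> x)" for x
    obtain c' where c: "commuting_homeo c c'" and hc: "\<And>x. x \<in> {0..1} \<Longrightarrow> h (c x) = \<omega> x"
      using conjugacy_imp_commuting_homeo[OF h mono \<omega>[unfolded \<psi>_def]] unfolding c_def by blast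
    have L0: "L \<ge> 0" using L by (rule lipschitz_on_nonneg)
    have c_mem: "c x \<in> {0..1}" "c' x \<in> {0..1}" "c (c' x) = x" if "x \<in> {0..1}" for x
      using c that unfolding commuting_homeo_def homeomorphism_def by blast+
    have lip: "\<bar>h (c x) - h (c y)\<bar> \<le> L * \<bar>x - y\<bar>" if "x \<in> {0..1}" "y \<in> {0..1}" for x y
      using lipschitz_onD[OF L that] hc that by (simp add: dist_real_def)
    have NL: "N * \<bar>h (c x) - h (c y)\<bar> \<le> N * L * \<bar>x - y\<bar>" if "x \<in> {0..1}" "y \<in> {0..1}" for x y
      using mult_left_mono[OF lip[OF that], of N] N by (simp add: mult.assoc)
    have NL0: "N * L \<ge> 0" using N L0 by simp
    \<comment> \<open>One constant for both bounds: the 1 in the maximum serves the Lipschitz bound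
      on \<open>c\<close>, and 1 / \<eta> the bound by \<open>H\<close>.\<close>
    define L' where "L' = N * L * max 1 (1 / \<eta>)"
    show False
    proof (rule no_centralizer[OF c])
      fix x y :: real assume xy: "x \<in> {0..1}" "y \<in> {0..1}"
      have "\<bar>c x - c y\<bar> \<le> N * L * \<bar>x - y\<bar>"
        using h_expand[OF c_mem(1)[OF xy(1)] c_mem(1)[OF xy(2)]] NL[OF xy] by linarith
      also have "\<dots> \<le> L' * \<bar>x - y\<bar>"
        using mult_left_mono[OF max.cobounded1[of 1 "1 / \<eta>"] NL0]
        by (intro mult_right_mono) (auto simp: L'_def)
      finally show "\<bar>c x - c y\<bar> \<le> L' * \<bar>x - y\<bar>" .
    next
      fix x :: real assume x: "x \<in> {0..1}"
      \<comment> \<open>The comparison point is \<open>c' e\<close>, which \<open>c\<close> sends to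
        the singular point.\<close>
      have "\<eta> * H \<bar>c x - e\<bar> \<le> N * L * \<bar>x - c' e\<bar>"
        using h_H[OF c_mem(1)[OF x]] NL[OF x c_mem(2)[OF e(1)]] c_mem(3)[OF e(1)] by simp
      then have "H \<bar>c x - e\<bar> \<le> N * L * (1 / \<eta>) * \<bar>x - c' e\<bar>"
        using \<eta> by (simp add: field_simps)
      also have "\<dots> \<le> L' * \<bar>x - c' e\<bar>"
        unfolding L'_def using NL0 by (intro mult_right_mono mult_left_mono) auto
      finally show "H \<bar>c x - e\<bar> \<le> L' * \<bar>x - c' e\<bar>" .
    qed
  qed
  moreover have "C1_norm (\<lambda>x. \<psi> s x - \<phi> s x) \<le> \<epsilon>" if s: "s \<in> S" for s
  proof -
    have a: "s \<in> carrier G" using s by (rule subsetD[OF S(2)])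
    have close: "\<bar>x - h x\<bar> < d s" if "x \<in> {0..1}" for x
      using h_id[OF that] \<eta>_d[OF s] by linarith
    have k_close: "\<bar>k y - y\<bar> < d s" if "y \<in> {0..1}" for y
      using close[OF hk(2)[OF that]] hk(4)[OF that] by simp
    have "\<bar>\<psi> s y - \<phi> s y\<bar> \<le> \<epsilon> / 2" if y: "y \<in> {0..1}" for y
    proof -
      have "\<bar>h (\<phi> s (k y)) - \<phi> s (k y)\<bar> < \<epsilon> / 4"
        using h_id[OF action_mem[OF a hk(2)[OF y]]] \<eta>_\<epsilon> by linarith
      moreover have "\<bar>\<phi> s (k y) - \<phi> s y\<bar> < \<epsilon> / 4"
        using d(2)[OF s hk(2)[OF y] y k_close[OF y]] by blast
      moreover have "\<psi> s y = h (\<phi> s (k y))" using y by (simp add: \<psi>_def)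
      ultimately show ?thesis by linarith
    qed
    moreover have "\<bar>unit_deriv (\<lambda>x. \<psi> s x - \<phi> s x) y\<bar> \<le> \<epsilon> / 2" if y: "y \<in> {0..1}" for y
    proof -
      let ?x = "k y"
      have x: "?x \<in> {0..1}" by (rule hk(2)[OF y])
      have "((\<lambda>x. \<psi> s x) has_real_derivative unit_deriv (\<phi> s) ?x * R s ?x) (at y within {0..1})"
        by (rule has_field_derivative_transform_within[OF deriv(2)[OF a y] zero_less_one y])
          (simp add: \<psi>_def)
      from DERIV_diff[OF this has_unit_deriv[OF Diff1_C1[OF action_Diff1[OF a]] y]]
      have eq: "unit_deriv (\<lambda>x. \<psi> s x - \<phi> s x) y = unit_deriv (\<phi> s) ?x * R s ?x - unit_deriv (\<phi> s) y"
        by (rule unit_deriv_eq[OF y])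
      \<comment> \<open>The derivative of the difference splits into the derivative at
        \<open>?x\<close> times \<open>R s ?x - 1\<close>, plus the difference of the derivatives at
        \<open>?x\<close> and \<open>y\<close>; each part is at most \<epsilon> / 4.\<close>
      have "\<bar>R s ?x - 1\<bar> \<le> \<epsilon>'"
        using near(2)[OF s] \<eta>_R[OF s, of ?x] x by (auto simp: R_def \<sigma>_ratio)
      moreover have pos: "unit_deriv (\<phi> s) ?x > 0" by (rule Diff1_unit_deriv_pos[OF action_Diff1[OF a] x])
      ultimately have "\<bar>unit_deriv (\<phi> s) ?x * (R s ?x - 1)\<bar> \<le> unit_deriv (\<phi> s) ?x * \<epsilon>'"
        by (simp add: abs_mult)
      then have "\<bar>unit_deriv (\<phi> s) ?x * R s ?x - unit_deriv (\<phi> s) ?x\<bar> \<le> \<epsilon> / 4"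
        using near(1)[OF s x] by (simp add: right_diff_distrib)
      moreover have "\<bar>unit_deriv (\<phi> s) ?x - unit_deriv (\<phi> s) y\<bar> < \<epsilon> / 4"
        using d(2)[OF s x y k_close[OF y]] by blast
      ultimately show ?thesis unfolding eq by linarith
    qed
    ultimately have "(SUP x\<in>{0..1}. \<bar>\<psi> s x - \<phi> s x\<bar>) \<le> \<epsilon> / 2"
        "(SUP x\<in>{0..1}. \<bar>unit_deriv (\<lambda>x. \<psi> s x - \<phi> s x) x\<bar>) \<le> \<epsilon> / 2"
      by (intro cSUP_least; simp)+
    then show ?thesis unfolding C1_norm_def by linarith
  qed
  ultimately show ?thesis using act top by blast
qed

end

section \<open>Actions with a hyperbolic global fixed point\<close>

text \<open>Close to \<open>e\<close> one step contracts distances to \<open>e\<close> by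
  \<open>p\<close>, and since p < 1 the orbit never leaves the neighbourhood where this
  holds.\<close>

lemma contracting_iterates:
  fixes f :: "real \<Rightarrow> real"
  assumes f: "f \<in> Diff1" "f e = e" "e \<in> {0..1}" and p: "unit_deriv f e < p" "p < 1"
  obtains r where "r > 0"
    "\<And>x n. x \<in> {0..1} \<Longrightarrow> \<bar>x - e\<bar> < r \<Longrightarrow> \<bar>(f ^^ n) x - e\<bar> \<le> p ^ n * \<bar>x - e\<bar>"
proof -
  have p0: "p > 0" using p(1) Diff1_unit_deriv_pos[OF f(1,3)] by linarith
  obtain r where r: "r > 0"
    "\<And>x. x \<in> {0..1} \<Longrightarrow> x \<noteq> e \<Longrightarrow> \<bar>x - e\<bar> < r \<Longrightarrow> \<bar>f x - e\<bar> / \<bar>x - e\<bar> < p"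
    using order_tendstoD(2)[OF abs_quotient_tendsto_deriv[OF has_unit_deriv[OF Diff1_C1[OF f(1)] f(3)] f(2)
          Diff1_unit_deriv_pos[OF f(1,3)]] p(1)]
    by (auto simp: eventually_at dist_real_def)
  have step: "\<bar>f x - e\<bar> \<le> p * \<bar>x - e\<bar>" if "x \<in> {0..1}" "\<bar>x - e\<bar> < r" for x
  proof (cases "x = e")
    case False
    then show ?thesis using r(2)[OF that(1) False that(2)] by (simp add: pos_divide_less_eq)
  qed (use f(2) in simp)
  have "(f ^^ n) x \<in> {0..1} \<and> \<bar>(f ^^ n) x - e\<bar> \<le> p ^ n * \<bar>x - e\<bar>"
    if x: "x \<in> {0..1}" "\<bar>x - e\<bar> < r" for x n
  proof (induction n)
    case (Suc n)
    have "p ^ n * \<bar>x - e\<bar> \<le> \<bar>x - e\<bar>" using p0 p(2) by (simp add: mult_left_le_one_le power_le_one)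
    then have lt: "\<bar>(f ^^ n) x - e\<bar> < r" using Suc.IH x(2) by linarith
    have "\<bar>f ((f ^^ n) x) - e\<bar> \<le> p * (p ^ n * \<bar>x - e\<bar>)"
      using step[OF conjunct1[OF Suc.IH] lt] mult_left_mono[OF conjunct2[OF Suc.IH], of p] p0 by linarith
    then show ?case using Diff1_mem[OF f(1) conjunct1[OF Suc.IH]] by (simp add: mult.assoc)
  qed (use x in simp)
  then show ?thesis using that r(1) by blast
qed

text \<open>The orbit may leave and reenter the neighbourhood of \<open>e\<close> in which a step
  loses at most the factor \<open>q\<close>. By compactness a step from outside ends at distance at
  least some m > 0, so at worst the estimate restarts from m.\<close>

lemma iterates_lower_bound:
  fixes f :: "real \<Rightarrow> real"
  assumes f: "f \<in> Diff1" "f e = e" "e \<in> {0..1}" and q: "0 < q" "q < unit_deriv f e" "q \<le> 1"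
    and y: "y \<in> {0..1}" "y \<noteq> e"
  obtains \<theta> where "\<theta> > 0" "\<And>n. \<theta> * q ^ n \<le> \<bar>(f ^^ n) y - e\<bar>"
proof -
  obtain r where r: "r > 0"
    "\<And>x. x \<in> {0..1} \<Longrightarrow> x \<noteq> e \<Longrightarrow> \<bar>x - e\<bar> < r \<Longrightarrow> q < \<bar>f x - e\<bar> / \<bar>x - e\<bar>"
    using order_tendstoD(1)[OF abs_quotient_tendsto_deriv[OF has_unit_deriv[OF Diff1_C1[OF f(1)] f(3)] f(2)
          Diff1_unit_deriv_pos[OF f(1,3)]] q(2)]
    by (auto simp: eventually_at dist_real_def)
  have near: "q * \<bar>x - e\<bar> \<le> \<bar>f x - e\<bar>" if "x \<in> {0..1}" "\<bar>x - e\<bar> < r" for x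
  proof (cases "x = e")
    case False
    then show ?thesis using r(2)[OF that(1) False that(2)] by (simp add: pos_less_divide_eq)
  qed (use f(2) in simp)
  define K where "K = {0..1} - ball e r"
  have K: "x \<in> {0..1}" "x \<noteq> e" if "x \<in> K" for x using that r(1) by (auto simp: K_def)
  have inK: "x \<in> K" if "x \<in> {0..1}" "\<not> \<bar>x - e\<bar> < r" for x
    using that by (auto simp: K_def dist_real_def abs_minus_commute)
  have cK: "compact K" unfolding K_def by (intro compact_diff) auto
  have "continuous_on K (\<lambda>x. \<bar>f x - e\<bar>)"
    by (intro continuous_intros continuous_on_subset[OF Diff1_continuous[OF f(1)]] subsetI K(1))
  \<comment> \<open>If every point of the interval is within \<open>r\<close> of \<open>e\<close>,
    then \<open>K\<close> is empty and the value 1 is chosen arbitrarily.\<close>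
  obtain m where m: "m > 0" "\<And>x. x \<in> K \<Longrightarrow> m \<le> \<bar>f x - e\<bar>"
  proof (cases "K = {}")
    case False
    then obtain x0 where x0: "x0 \<in> K" "\<And>x. x \<in> K \<Longrightarrow> \<bar>f x0 - e\<bar> \<le> \<bar>f x - e\<bar>"
      using continuous_attains_inf[OF cK False \<open>continuous_on K (\<lambda>x. \<bar>f x - e\<bar>)\<close>] by blast
    have "f x0 \<noteq> f e"
      using Diff1_bij_betw[OF f(1)] K[OF x0(1)] f(3) by (auto simp: bij_betw_def inj_on_def)
    then show ?thesis using that[of "\<bar>f x0 - e\<bar>"] x0(2) f(2) by auto
  qed (use that[of 1] in auto)
  define \<theta> where "\<theta> = min \<bar>y - e\<bar> m"
  have \<theta>: "\<theta> > 0" using y(2) m(1) by (simp add: \<theta>_def)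
  have "(f ^^ n) y \<in> {0..1} \<and> \<theta> * q ^ n \<le> \<bar>(f ^^ n) y - e\<bar>" for n
  proof (induction n)
    case 0
    then show ?case using y(1) by (simp add: \<theta>_def)
  next
    case (Suc n)
    let ?x = "(f ^^ n) y"
    have "\<theta> * q ^ Suc n \<le> \<bar>f ?x - e\<bar>"
    proof (cases "\<bar>?x - e\<bar> < r")
      case True
      have "q * (\<theta> * q ^ n) \<le> q * \<bar>?x - e\<bar>" using Suc.IH q(1) by (intro mult_left_mono) auto
      then show ?thesis using near[of ?x] Suc.IH True by (simp add: mult.left_commute)
    next
      case False
      have "\<theta> * q ^ Suc n \<le> \<theta>"
        using \<theta> power_le_one[OF less_imp_le[OF q(1)] q(3), of "Suc n"] mult_left_le[of "q ^ Suc n" \<theta>]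
        by (simp del: power_Suc)
      then show ?thesis using m(2)[OF inK[OF conjunct1[OF Suc.IH] False]] by (simp add: \<theta>_def)
    qed
    then show ?case using Diff1_mem[OF f(1) conjunct1[OF Suc.IH]] by simp
  qed
  then show ?thesis using that \<theta> by blast
qed

text \<open>The condition \<delta> < 1 keeps the primitive continuous at 0. Homogeneity of the
  density turns the limit ratio at a fixed point into the derivative there raised to the power
  -\<delta>.\<close>

lemma singular_profile_powr:
  assumes "0 < \<delta>" "\<delta> < 1"
  shows "singular_profile (\<lambda>t. t powr (1 - \<delta>)) (\<lambda>t. (1 - \<delta>) * t powr (- \<delta>))"
proof
  show "continuous_on {0..} (\<lambda>t::real. t powr (1 - \<delta>))"
    using assms by (intro continuous_on_powr' continuous_intros) auto
  show "((\<lambda>t. t powr (1 - \<delta>)) has_real_derivative (1 - \<delta>) * t powr (- \<delta>)) (at t)" if "t > 0" for t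
    using has_real_derivative_powr[OF that, of "1 - \<delta>"] by simp
  show "continuous_on {0<..} (\<lambda>t. (1 - \<delta>) * t powr (- \<delta>))"
    by (intro continuous_intros) auto
  have "LIM t at_right 0. t powr (- \<delta>) :> at_top"
    unfolding powr_minus
  proof (rule filterlim_inverse_at_top)
    show "((\<lambda>t::real. t powr \<delta>) \<longlongrightarrow> 0) (at_right 0)"
      using tendsto_powr'[OF tendsto_ident_at tendsto_const, of 0 \<delta> "{0<..}"] assms(1)
      by (simp add: eventually_at_filter)
  qed (simp add: eventually_at_filter)
  then show "LIM t at_right 0. (1 - \<delta>) * t powr (- \<delta>) :> at_top"
    using assms(2) by (intro filterlim_tendsto_pos_mult_at_top[OF tendsto_const]) auto
qed (use assms in auto)

section \<open>Derivatives at global fixed points and the hyperbolic case\<close>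

context interval_action
begin

lemma commuting_homeoD:
  assumes "commuting_homeo c c'" "x \<in> {0..1}"
  shows "c x \<in> {0..1}" "c' x \<in> {0..1}" "c' (c x) = x" "c (c' x) = x"
    and "g \<in> carrier G \<Longrightarrow> c (\<phi> g x) = \<phi> g (c x)"
  using assms unfolding commuting_homeo_def homeomorphism_def by blast+

text \<open>The map \<open>c\<close> carries the orbit of a point \<open>z\<close> under
  \<open>s\<close> to the orbit of \<open>c z\<close>, so two rates can be compared. The first orbit
  approaches \<open>e\<close> at least as fast as a multiple of \<open>p ^ n\<close>, the second
  approaches \<open>c e\<close> at most as fast as a multiple of \<open>q ^ n\<close>, and the bound
  by \<open>L\<close> is incompatible with p < q^\<alpha>. The uses are \<alpha> = 1, for Lipschitz
  \<open>c\<close>, and \<alpha> = 1 - \<delta>, where \<open>c e\<close> is the singular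
  point.\<close>

lemma commuting_derivative_le:
  assumes c: "commuting_homeo c c'" and s: "s \<in> carrier G"
    and e: "e \<in> {0..1}" "\<phi> s e = e" "unit_deriv (\<phi> s) e < 1"
    and \<alpha>: "\<alpha> > 0"
    and L: "\<And>x. x \<in> {0..1} \<Longrightarrow> \<bar>c x - c e\<bar> powr \<alpha> \<le> L * \<bar>x - e\<bar>"
  shows "unit_deriv (\<phi> s) (c e) powr \<alpha> \<le> unit_deriv (\<phi> s) e"
proof (rule ccontr)
  note cD = commuting_homeoD[OF c]
  have D: "\<phi> s \<in> Diff1" by (rule action_Diff1[OF s])
  let ?d = "unit_deriv (\<phi> s) e" and ?d1 = "unit_deriv (\<phi> s) (c e)"
  have d: "?d > 0" "?d1 > 0" using Diff1_unit_deriv_pos[OF D] e(1) cD(1)[OF e(1)] by auto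
  assume "\<not> ?d1 powr \<alpha> \<le> ?d"
  then have "?d < min 1 (?d1 powr \<alpha>)" using e(3) by simp
  \<comment> \<open>If the inequality fails, there is room for rates \<open>p\<close> and
    \<open>q\<close> below 1 with \<open>?d < p\<close>, \<open>q < ?d1\<close> and p < q^\<alpha>;
    \<open>q\<close> is taken above p^(1/\<alpha>).\<close>
  then obtain p where p: "?d < p" "p < 1" "p < ?d1 powr \<alpha>"
    using dense[of ?d "min 1 (?d1 powr \<alpha>)"] by auto
  have p0: "p > 0" using p(1) d(1) by linarith
  have "p powr (1 / \<alpha>) < (?d1 powr \<alpha>) powr (1 / \<alpha>)" using p p0 \<alpha> by (intro powr_less_mono2) auto
  then have "p powr (1 / \<alpha>) < ?d1" using \<alpha> d by (simp add: powr_powr)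
  moreover have "p powr (1 / \<alpha>) < 1" using p p0 \<alpha> powr_less_mono2[of "1 / \<alpha>" p 1] by simp
  ultimately have "p powr (1 / \<alpha>) < min 1 ?d1" by simp
  then obtain q where q: "p powr (1 / \<alpha>) < q" "q < 1" "q < ?d1" 
    using dense[of "p powr (1 / \<alpha>)" "min 1 ?d1"] by auto
  have q0: "q > 0" using q(1) powr_ge_zero[of p "1 / \<alpha>"] by linarith
  have "(p powr (1 / \<alpha>)) powr \<alpha> < q powr \<alpha>" using q(1) \<alpha> by (intro powr_less_mono2) auto
  then have pq: "p < q powr \<alpha>" using \<alpha> p0 by (simp add: powr_powr)
  obtain r where r: "r > 0"
    "\<And>x n. x \<in> {0..1} \<Longrightarrow> \<bar>x - e\<bar> < r \<Longrightarrow> \<bar>(\<phi> s ^^ n) x - e\<bar> \<le> p ^ n * \<bar>x - e\<bar>"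
    using contracting_iterates[OF D e(2,1) p(1,2)] by blast
  have "e islimpt {0..1}" using e(1) by (simp add: islimpt_Icc)
  then obtain z where z: "z \<in> {0..1}" "z \<noteq> e" "\<bar>z - e\<bar> < r"
    using r(1) unfolding islimpt_approachable dist_real_def by blast
  have ce: "\<phi> s (c e) = c e" using cD(5)[OF e(1) s] e(2) by simp
  have "c z \<noteq> c e" using cD(3)[OF z(1)] cD(3)[OF e(1)] z(2) by metis
  then obtain \<theta> where \<theta>: "\<theta> > 0" "\<And>n. \<theta> * q ^ n \<le> \<bar>(\<phi> s ^^ n) (c z) - c e\<bar>"
    using iterates_lower_bound[OF D ce cD(1)[OF e(1)] q0 q(3) less_imp_le[OF q(2)] cD(1)[OF z(1)]] by blast
  have iter: "(\<phi> s ^^ n) z \<in> {0..1} \<and> c ((\<phi> s ^^ n) z) = (\<phi> s ^^ n) (c z)" for n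
  proof (induction n)
    case (Suc n)
    then show ?case using cD(5)[OF conjunct1[OF Suc] s] action_mem[OF s conjunct1[OF Suc]] by simp
  qed (use z in simp)
  have L0: "L \<ge> 0"
  proof -
    have "0 \<le> L * \<bar>z - e\<bar>" using L[OF z(1)] powr_ge_zero order_trans by blast
    then show ?thesis using z(2) by (simp add: zero_le_mult_iff)
  qed
  \<comment> \<open>\<rho> > 1 is the gap between the two rates; the orbit comparison would bound
    all its powers.\<close>
  define \<rho> where "\<rho> = q powr \<alpha> / p"
  have bound: "\<rho> ^ n \<le> L * \<bar>z - e\<bar> / \<theta> powr \<alpha>" for n
  proof -
    have "(\<theta> * q ^ n) powr \<alpha> \<le> \<bar>c ((\<phi> s ^^ n) z) - c e\<bar> powr \<alpha>"
      using \<theta> iter[of n] q0 \<alpha> by (intro powr_mono2) auto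
    also have "\<dots> \<le> L * \<bar>(\<phi> s ^^ n) z - e\<bar>" using L iter by blast
    also have "\<dots> \<le> L * (p ^ n * \<bar>z - e\<bar>)" using L0 r(2)[OF z(1,3)] by (intro mult_left_mono)
    finally have "(\<theta> * q ^ n) powr \<alpha> \<le> L * (p ^ n * \<bar>z - e\<bar>)" .
    moreover have "(\<theta> * q ^ n) powr \<alpha> = \<theta> powr \<alpha> * (q powr \<alpha>) ^ n"
      using \<theta>(1) q0 by (simp add: powr_mult powr_power powr_realpow[symmetric] powr_powr mult.commute)
    ultimately have "\<theta> powr \<alpha> * (q powr \<alpha>) ^ n \<le> L * \<bar>z - e\<bar> * p ^ n" by (simp add: mult_ac)
    then show ?thesis using \<theta>(1) p0 by (simp add: \<rho>_def power_divide field_simps)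
  qed
  have "\<rho> > 1" using pq p0 by (simp add: \<rho>_def)
  then obtain n where "L * \<bar>z - e\<bar> / \<theta> powr \<alpha> < \<rho> ^ n" using real_arch_pow by blast
  then show False using bound[of n] by simp
qed

lemma unit_deriv_action_bounded:
  assumes "finite S" "S \<subseteq> carrier G"
  obtains M where "M > 0" "\<And>s x. s \<in> S \<Longrightarrow> x \<in> {0..1} \<Longrightarrow> unit_deriv (\<phi> s) x \<le> M"
proof -
  have "\<forall>s\<in>S. \<exists>B. \<forall>x\<in>{0..1}. unit_deriv (\<phi> s) x \<le> B"
  proof
    fix s assume "s \<in> S"
    then have "s \<in> carrier G" by (rule subsetD[OF assms(2)])
    then have "continuous_on {0..1} (unit_deriv (\<phi> s))"
      by (intro continuous_on_unit_deriv Diff1_C1 action_Diff1)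
    then have "\<exists>x\<in>{0..1}. \<forall>y\<in>{0..1}. unit_deriv (\<phi> s) y \<le> unit_deriv (\<phi> s) x"
      by (intro continuous_attains_sup) auto
    then show "\<exists>B. \<forall>x\<in>{0..1}. unit_deriv (\<phi> s) x \<le> B" by blast
  qed
  then obtain B where B: "\<forall>s\<in>S. \<forall>x\<in>{0..1}. unit_deriv (\<phi> s) x \<le> B s"
    unfolding bchoice_iff by blast
  show ?thesis
  proof (rule that)
    show "Max (insert 1 (B ` S)) > 0"
      by (rule less_le_trans[OF zero_less_one Max_ge]) (use assms(1) in auto)
    fix s and x :: real assume "s \<in> S" "x \<in> {0..1}"
    then have "unit_deriv (\<phi> s) x \<le> B s" using B by blast
    also have "\<dots> \<le> Max (insert 1 (B ` S))" using assms(1) \<open>s \<in> S\<close> by (intro Max_ge) auto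
    finally show "unit_deriv (\<phi> s) x \<le> Max (insert 1 (B ` S))" .
  qed
qed

definition global_fixed :: "real set" where
  "global_fixed = {x \<in> {0..1}. \<forall>a\<in>carrier G. \<phi> a x = x}"

lemma commuting_homeo_global_fixed:
  assumes "commuting_homeo c c'" "x \<in> global_fixed"
  shows "c x \<in> global_fixed"
  using assms commuting_homeoD[OF assms(1), of x] unfolding global_fixed_def by auto

text \<open>An accumulation point of such fixed points is fixed by \<open>s\<close>, and the
  difference quotients along the set all equal 1, so the derivative there is 1. Continuity of the
  derivative would make it at most v < 1.\<close>

lemma finite_hyperbolic_fixed:
  assumes s: "s \<in> carrier G" and v: "v < 1"
  shows "finite {x \<in> global_fixed. unit_deriv (\<phi> s) x \<le> v}" (is "finite ?E")
proof (rule ccontr)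
  assume "infinite ?E"
  moreover have "?E \<subseteq> {0..1}" by (auto simp: global_fixed_def)
  ultimately obtain p where p: "p \<in> {0..1}" "p islimpt ?E"
    using compact_Icc[of "0::real" 1] unfolding compact_eq_Bolzano_Weierstrass by blast
  have D: "\<phi> s \<in> Diff1" by (rule action_Diff1[OF s])
  have E: "?E \<subseteq> {0..1}" by (auto simp: global_fixed_def)
  have nontriv: "at p within ?E \<noteq> bot" using p(2) by (simp add: trivial_limit_within)
  have "((\<lambda>x. (\<phi> s x - \<phi> s p) / (x - p)) \<longlongrightarrow> unit_deriv (\<phi> s) p) (at p within ?E)"
    by (rule tendsto_within_subset[OF _ E])
      (use has_unit_deriv[OF Diff1_C1[OF D] p(1)] in \<open>simp add: has_field_derivative_iff\<close>)
  moreover have "\<phi> s p = p"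
  proof -
    have lim: "(\<phi> s \<longlongrightarrow> \<phi> s p) (at p within ?E)"
      by (rule tendsto_within_subset[OF _ E])
        (use Diff1_continuous[OF D] p(1) in \<open>auto simp: continuous_on_def\<close>)
    have "((\<lambda>x. x) \<longlongrightarrow> \<phi> s p) (at p within ?E)"
      by (rule Lim_transform_eventually[OF lim])
        (use s in \<open>auto simp: eventually_at_filter global_fixed_def\<close>)
    then show ?thesis using tendsto_unique[OF nontriv _ tendsto_ident_at] by blast
  qed
  ultimately have "((\<lambda>x. 1) \<longlongrightarrow> unit_deriv (\<phi> s) p) (at p within ?E)"
    by (rule_tac Lim_transform_eventually)
      (use s in \<open>auto simp: eventually_at_filter global_fixed_def\<close>)
  then have "unit_deriv (\<phi> s) p = 1"
    using tendsto_unique[OF nontriv _ tendsto_const] by blast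
  moreover have "unit_deriv (\<phi> s) p \<le> v"
  proof (rule tendsto_upperbound[OF _ _ nontriv])
    show "(unit_deriv (\<phi> s) \<longlongrightarrow> unit_deriv (\<phi> s) p) (at p within ?E)"
      by (rule tendsto_within_subset[OF _ E])
        (use continuous_on_unit_deriv[OF Diff1_C1[OF D]] p(1) in \<open>auto simp: continuous_on_def\<close>)
    show "\<forall>\<^sub>F x in at p within ?E. unit_deriv (\<phi> s) x \<le> v" by (auto simp: eventually_at_filter)
  qed
  ultimately show False using v by simp
qed

lemma hyperbolic_approximation:
  assumes s: "s \<in> carrier G" and e: "e \<in> global_fixed" "unit_deriv (\<phi> s) e < 1"
    and S: "finite S" "S \<subseteq> carrier G" and \<epsilon>: "\<epsilon> > 0"
  shows "\<exists>\<phi>'. C1_action G \<phi>' \<and> (topologically_conjugate G \<phi> \<phi>' \<and> \<not> Lipschitz_conjugate G \<phi> \<phi>') \<and>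
    (\<forall>s\<in>S. C1_norm (\<lambda>x. \<phi>' s x - \<phi> s x) \<le> \<epsilon>)"
proof -
  let ?D = "unit_deriv (\<phi> s)"
  define E where "E = {x \<in> global_fixed. ?D x \<le> ?D e}"
  have fin: "finite E" unfolding E_def by (rule finite_hyperbolic_fixed[OF s e(2)])
  have "e \<in> E" using e(1) by (simp add: E_def)
  then have "Max (?D ` E) \<in> ?D ` E" using fin by (intro Max_in) auto
  \<comment> \<open>The singularity is placed where the derivative is largest within
    \<open>E\<close>. As that value is below 1, raising it to the power 1 - \<delta> lifts it above
    the derivative at every point of \<open>E\<close>.\<close>
  then obtain e0 where e0: "e0 \<in> E" "?D e0 = Max (?D ` E)" by auto
  have max: "?D x \<le> ?D e0" if "x \<in> E" for x
    unfolding e0(2) using fin that by (intro Max_ge) auto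
  have E: "x \<in> {0..1}" "\<And>a. a \<in> carrier G \<Longrightarrow> \<phi> a x = x" "?D x < 1" if "x \<in> E" for x
    using that e(2) by (auto simp: E_def global_fixed_def)
  have pos: "unit_deriv (\<phi> a) e0 > 0" if "a \<in> carrier G" for a
    by (rule Diff1_unit_deriv_pos[OF action_Diff1[OF that] E(1)[OF e0(1)]])
  obtain M where M: "M > 0" "\<And>s x. s \<in> S \<Longrightarrow> x \<in> {0..1} \<Longrightarrow> unit_deriv (\<phi> s) x \<le> M"
    using unit_deriv_action_bounded[OF S] by blast
  \<comment> \<open>The derivative bound \<open>M\<close> turns a relative error \<epsilon>' into at
    most \<epsilon> / 4. A small \<delta> achieves this error, because the limit ratios are powers
    with exponent -\<delta> and tend to 1 with \<delta> tending to 0.\<close>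
  define \<epsilon>' where "\<epsilon>' = \<epsilon> / (4 * M)"
  have "\<forall>\<^sub>F \<delta> in at_right 0. \<bar>unit_deriv (\<phi> a) e0 powr (- \<delta>) - 1\<bar> < \<epsilon>'" if "a \<in> S" for a
  proof -
    have "((\<lambda>\<delta>. \<bar>unit_deriv (\<phi> a) e0 powr (- \<delta>) - 1\<bar>) \<longlongrightarrow> \<bar>unit_deriv (\<phi> a) e0 powr (- 0) - 1\<bar>) (at_right 0)"
      using pos[OF subsetD[OF S(2) that]] by (intro tendsto_intros) auto
    then show ?thesis
      using pos[OF subsetD[OF S(2) that]] \<epsilon> M(1) by (intro order_tendstoD(2)) (auto simp: \<epsilon>'_def)
  qed
  then have "\<forall>\<^sub>F \<delta> in at_right 0. \<forall>a\<in>S. \<bar>unit_deriv (\<phi> a) e0 powr (- \<delta>) - 1\<bar> < \<epsilon>'"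
    using S(1) by (simp add: eventually_ball_finite)
  moreover have "\<forall>\<^sub>F \<delta> in at_right 0. \<delta> \<in> {0<..<1::real}" by (rule eventually_at_right_real) simp
  ultimately have "\<forall>\<^sub>F \<delta> in at_right 0. (\<forall>a\<in>S. \<bar>unit_deriv (\<phi> a) e0 powr (- \<delta>) - 1\<bar> < \<epsilon>') \<and> \<delta> \<in> {0<..<1}"
    by (rule eventually_conj)
  from eventually_happens'[OF trivial_limit_at_right_real this]
  obtain \<delta> where \<delta>: "0 < \<delta>" "\<delta> < 1" "\<And>a. a \<in> S \<Longrightarrow> \<bar>unit_deriv (\<phi> a) e0 powr (- \<delta>) - 1\<bar> < \<epsilon>'"
    by auto
  show ?thesis
  proof (rule singular_approximation[OF singular_profile_powr[OF \<delta>(1,2)] E(1)[OF e0(1)] E(2)[OF e0(1)] _ S \<epsilon> _ \<delta>(3)])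
    fix a assume a: "a \<in> carrier G"
    have "((\<lambda>x. \<bar>\<phi> a x - e0\<bar> / \<bar>x - e0\<bar>) \<longlongrightarrow> unit_deriv (\<phi> a) e0) (at e0 within {0..1})"
      by (rule abs_quotient_tendsto_deriv[OF has_unit_deriv[OF Diff1_C1[OF action_Diff1[OF a]] E(1)[OF e0(1)]]
            E(2)[OF e0(1) a] pos[OF a]])
    then have "((\<lambda>x. (\<bar>\<phi> a x - e0\<bar> / \<bar>x - e0\<bar>) powr (- \<delta>)) \<longlongrightarrow> unit_deriv (\<phi> a) e0 powr (- \<delta>)) (at e0 within {0..1})"
      using pos[OF a] by (intro tendsto_powr tendsto_const) auto
    then show "((\<lambda>x. (1 - \<delta>) * \<bar>\<phi> a x - e0\<bar> powr (- \<delta>) / ((1 - \<delta>) * \<bar>x - e0\<bar> powr (- \<delta>)))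
        \<longlongrightarrow> unit_deriv (\<phi> a) e0 powr (- \<delta>)) (at e0 within {0..1})"
      using \<delta>(2) by (simp add: powr_divide)
  next
    fix a and x :: real assume "a \<in> S" "x \<in> {0..1}"
    then have "unit_deriv (\<phi> a) x * \<epsilon>' \<le> M * \<epsilon>'" using M \<epsilon> by (intro mult_right_mono) (auto simp: \<epsilon>'_def)
    then show "unit_deriv (\<phi> a) x * \<epsilon>' \<le> \<epsilon> / 4" using M(1) by (simp add: \<epsilon>'_def)
  next
    fix c c' L assume c: "commuting_homeo c c'"
      and lip: "\<And>x y. x \<in> {0..1} \<Longrightarrow> y \<in> {0..1} \<Longrightarrow> \<bar>c x - c y\<bar> \<le> L * \<bar>x - y\<bar>"
      and sing: "\<And>x. x \<in> {0..1} \<Longrightarrow> \<bar>c x - e0\<bar> powr (1 - \<delta>) \<le> L * \<bar>x - c' e0\<bar>"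
    note cD = commuting_homeoD[OF c]
    have "c ` E \<subseteq> E - {e0}"
    proof (rule image_subsetI)
      fix x assume x: "x \<in> E"
      note Ex = E[OF x]
      \<comment> \<open>The Lipschitz bound, with exponent 1, shows that \<open>c\<close> maps
        \<open>E\<close> into itself.\<close>
      have "?D (c x) powr 1 \<le> ?D x"
        by (rule commuting_derivative_le[OF c s Ex(1) Ex(2)[OF s] Ex(3), of 1 L]) (use lip Ex(1) in auto)
      moreover have "?D (c x) > 0"
        by (rule Diff1_unit_deriv_pos[OF action_Diff1[OF s] cD(1)[OF Ex(1)]])
      ultimately have "?D (c x) \<le> ?D e" using x by (simp add: E_def)
      then have "c x \<in> E" using x commuting_homeo_global_fixed[OF c] by (simp add: E_def)
      moreover have "c x \<noteq> e0"
      proof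
        \<comment> \<open>A point sent to \<open>e0\<close> has to satisfy the inequality with
          exponent 1 - \<delta>, which contradicts the maximality of the derivative at
          \<open>e0\<close>.\<close>
        assume cx: "c x = e0"
        then have "c' e0 = x" using cD(3)[OF Ex(1)] by simp
        then have "?D (c x) powr (1 - \<delta>) \<le> ?D x"
          using sing \<delta> by (intro commuting_derivative_le[OF c s Ex(1) Ex(2)[OF s] Ex(3), of "1 - \<delta>" L])
            (auto simp: cx)
        then have "?D e0 powr (1 - \<delta>) \<le> ?D e0 powr 1" using max[OF x] cx pos[OF s] by simp
        then show False
          using powr_less_mono'[of "?D e0" "1 - \<delta>" 1] pos[OF s] E(3)[OF e0(1)] \<delta>(1) by simp
      qed
      ultimately show "c x \<in> E - {e0}" by simp
    qed
    moreover have "inj_on c E" by (rule inj_on_inverseI[where g=c']) (use cD(3) E(1) in blast)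
    ultimately have "card E \<le> card (E - {e0})" using fin by (intro card_inj_on_le) auto
    then show False using card_Diff1_less[OF fin e0(1)] by simp
  qed
qed

end

section \<open>Actions whose global fixed points are parabolic\<close>

text \<open>The numbers \<open>Y j n\<close> may be far smaller than \<open>X j n\<close>, so
  \<open>H\<close> has to vanish slowly enough at 0 for all \<open>j\<close> together. Pairs are
  coded by k, each \<open>j\<close> being the first component of infinitely many codes, and a
  summand of \<open>H\<close> of total height (1/2)^k settles the demand number k. The two
  inequalities for \<open>g\<close> are what keeps its ratio at a parabolic fixed point tending to
  1.\<close>

lemma diagonal_profile:
  fixes X Y :: "nat \<Rightarrow> nat \<Rightarrow> real"
  assumes X: "\<And>j. X j \<longlonglongrightarrow> 0" and Y: "\<And>j n. Y j n > 0"
  obtains H g where "singular_profile H g"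
    "\<And>t u. 0 < t \<Longrightarrow> t \<le> u \<Longrightarrow> g u \<le> g t" "\<And>t u. 0 < t \<Longrightarrow> t \<le> u \<Longrightarrow> g t \<le> (u / t)\<^sup>2 * g u"
    "\<And>j L. \<exists>n. H (Y j n) > L * X j n"
proof -
  have "\<exists>n. \<bar>X (fst (prod_decode k)) n\<bar> < (1/4) ^ k" for k
    using LIMSEQ_D[OF X[of "fst (prod_decode k)"], of "(1/4) ^ k"] by auto
  then obtain \<nu> where \<nu>: "\<And>k. \<bar>X (fst (prod_decode k)) (\<nu> k)\<bar> < (1/4) ^ k" by metis
  \<comment> \<open>The scale is at most the relevant \<open>Y\<close>, so that the summand has
    reached half its height there. The cap (1/4)^k forces the slope of the summand at 0, namely
    (1/2)^k / y k, to be at least 2^k.\<close>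
  define y where "y k = min (Y (fst (prod_decode k)) (\<nu> k)) ((1/4) ^ k)" for k
  have y: "y k > 0" "y k \<le> (1/4) ^ k" "y k \<le> 1" for k
    using Y power_le_one[of "1/4::real" k] by (auto simp: y_def intro: min.coboundedI2)
  \<comment> \<open>Each summand of \<open>g\<close> varies by at most the square of the ratio of its arguments, hence so
    does \<open>g\<close>, whatever the sequence \<open>y\<close>; and \<open>H (y k)\<close> is at least \<open>(1/2) ^ k / 2\<close>.\<close>
  define hk where "hk k t = (1/2) ^ k * (t / (t + y k))" for k t
  define gk where "gk k t = (1/2) ^ k * (y k / (t + y k)\<^sup>2)" for k t
  define H where "H t = (\<Sum>k. hk k t)" for t
  define g where "g t = (\<Sum>k. gk k t)" for t
  have four: "(4::real) ^ k = 2 ^ k * 2 ^ k" for k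
    using power_mult_distrib[of "2::real" 2 k] by simp
  have geo: "summable (\<lambda>k. (1/2::real) ^ k)" by (rule summable_geometric) simp
  have hk: "0 \<le> hk k t" "hk k t \<le> (1/2) ^ k" if "t \<ge> 0" for k t
  proof -
    have "0 \<le> t / (t + y k)" "t / (t + y k) \<le> 1" using y(1)[of k] that by auto
    then show "0 \<le> hk k t" "hk k t \<le> (1/2) ^ k"
      using mult_left_le[of "t / (t + y k)" "(1/2) ^ k"] by (auto simp: hk_def simp del: times_divide_eq_right)
  qed
  have hk_sum: "summable (\<lambda>k. hk k t)" if "t \<ge> 0" for t
    by (rule summable_comparison_test[OF _ geo]) (use hk[OF that] in auto)
  have gk_pos: "gk k t > 0" if "t > 0" for k t
    using y(1)[of k] that by (simp add: gk_def)
  have gk_le: "gk k t \<le> (1/2) ^ k * (1 / a\<^sup>2)" if "0 < a" "a \<le> t" for k a t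
  proof -
    have "a\<^sup>2 \<le> (t + y k)\<^sup>2" using that y(1)[of k] by (intro power_mono) auto
    then have "y k / (t + y k)\<^sup>2 \<le> 1 / a\<^sup>2" using y[of k] that by (intro frac_le) auto
    then show ?thesis unfolding gk_def by (intro mult_left_mono) auto
  qed
  have geo': "summable (\<lambda>k. (1/2::real) ^ k * (1 / a\<^sup>2))" for a by (rule summable_mult2[OF geo])
  have gk_sum: "summable (\<lambda>k. gk k t)" if "t > 0" for t
    by (rule summable_comparison_test[OF _ geo'[of t]])
      (use gk_le[OF that order_refl] less_imp_le[OF gk_pos[OF that]] in auto)
  have gk_unif: "uniform_limit {a..} (\<lambda>n t. \<Sum>k<n. gk k t) g sequentially" if "a > 0" for a
    unfolding g_def
  proof (rule Weierstrass_m_test[OF _ geo'[of a]])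
    show "norm (gk k t) \<le> (1/2) ^ k * (1 / a\<^sup>2)" if "t \<in> {a..}" for k t
      using gk_le[of a t k] gk_pos[of t k] \<open>a > 0\<close> that by simp
  qed
  have g_cont: "isCont g t" if t: "t > 0" for t
  proof -
    have "continuous_on {t/2..} g"
      by (rule uniform_limit_theorem[OF always_eventually gk_unif])
        (use t y(1) in \<open>auto simp: gk_def intro!: continuous_intros simp: add_nonneg_eq_0_iff less_imp_neq[THEN not_sym] add_pos_pos\<close>)
    then show ?thesis using t by (intro continuous_on_interior) auto
  qed
  have H_deriv: "(H has_real_derivative g t) (at t)" if t: "t > 0" for t
    unfolding H_def[abs_def] g_def
  proof (rule has_field_derivative_series'(2)[of "{t/2..}" hk gk t])
    fix k x assume x: "x \<in> {t/2..}"
    then have "x + y k > 0" using t y(1)[of k] by auto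
    then have "((\<lambda>x. x / (x + y k)) has_real_derivative y k / (x + y k)\<^sup>2) (at x within {t/2..})"
      by (auto intro!: derivative_eq_intros simp: power2_eq_square)
    from DERIV_cmult[OF this, of "(1/2) ^ k"]
    show "(hk k has_real_derivative gk k x) (at x within {t/2..})"
      by (simp only: hk_def[abs_def] gk_def)
  next
    show "uniformly_convergent_on {t/2..} (\<lambda>n x. \<Sum>i<n. gk i x)"
      using gk_unif[of "t/2"] t by (auto simp: uniformly_convergent_on_def)
    show "summable (\<lambda>k. hk k t)" using hk_sum t by simp
  qed (use t in auto)
  have g_anti: "g u \<le> g t" if "0 < t" "t \<le> u" for t u
    unfolding g_def
  proof (rule suminf_le)
    show "gk k u \<le> gk k t" for k
      unfolding gk_def using that y(1)[of k]
      by (intro mult_left_mono divide_left_mono power_mono mult_pos_pos zero_less_power) auto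
  qed (use gk_sum that in auto)
  have g_slow: "g t \<le> (u / t)\<^sup>2 * g u" if "0 < t" "t \<le> u" for t u
    unfolding g_def suminf_mult[OF gk_sum[OF less_le_trans[OF that]], symmetric]
  proof (rule suminf_le)
    show "gk k t \<le> (u / t)\<^sup>2 * gk k u" for k
    proof -
      have "1 / (t + y k) \<le> (u / t) * (1 / (u + y k))"
      proof -
        have u: "u > 0" using that by linarith
        have "t * (u + y k) \<le> u * (t + y k)"
          using mult_right_mono[OF that(2) less_imp_le[OF y(1)], of k] by (simp add: algebra_simps)
        then have "u / (u * (t + y k)) \<le> u / (t * (u + y k))"
          using u that(1) y(1)[of k] by (intro divide_left_mono) auto
        then show ?thesis using u by simp
      qed
      then have "(1 / (t + y k))\<^sup>2 \<le> ((u / t) * (1 / (u + y k)))\<^sup>2"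
        using that y(1)[of k] by (intro power_mono) auto
      then have "(1/2) ^ k * y k * (1 / (t + y k))\<^sup>2 \<le> (1/2) ^ k * y k * ((u / t) * (1 / (u + y k)))\<^sup>2"
        using y(1)[of k] by (intro mult_left_mono) auto
      then show ?thesis by (simp add: gk_def power_divide power_mult_distrib mult_ac)
    qed
  qed (use gk_sum that in \<open>auto intro: summable_mult\<close>)
  have gk_le_g: "gk k t \<le> g t" if "t > 0" for k t
    using sum_le_suminf[OF gk_sum[OF that], of "{k}"] less_imp_le[OF gk_pos[OF that]] by (simp add: g_def)
  have hk_le_H: "hk k t \<le> H t" if "t \<ge> 0" for k t
    using sum_le_suminf[OF hk_sum[OF that], of "{k}"] hk(1)[OF that] by (simp add: H_def)
  have "singular_profile H g"
  proof
    show "H 0 = 0" by (simp add: H_def hk_def)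
    show "continuous_on {0..} H"
    proof (rule uniform_limit_theorem[OF always_eventually])
      show "uniform_limit {0..} (\<lambda>n t. \<Sum>k<n. hk k t) H sequentially"
        unfolding H_def[abs_def] by (rule Weierstrass_m_test[OF _ geo]) (use hk in auto)
      have "t + y k \<noteq> 0" if "t \<in> {0..}" for k t using that y(1)[of k] by auto
      then show "\<forall>n. continuous_on {0..} (\<lambda>t. \<Sum>k<n. hk k t)"
        unfolding hk_def by (intro allI continuous_intros) auto
    qed simp
    show "(H has_real_derivative g t) (at t)" if "t > 0" for t by (rule H_deriv[OF that])
    show "g t > 0" if "t > 0" for t
      using gk_le_g[OF that, of 0] gk_pos[OF that, of 0] by linarith
    show "continuous_on {0<..} g" using g_cont by (intro continuous_at_imp_continuous_on) auto
    show "filterlim g at_top (at_right 0)"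
      unfolding filterlim_at_top
    proof
      fix Z :: real
      obtain k where k: "4 * Z < 2 ^ k" using real_arch_pow[of 2 "4 * Z"] by auto
      \<comment> \<open>On (0, y k) a single summand of \<open>g\<close> is large enough: it is at
        least 2^k / 4.\<close>
      have "Z \<le> g t" if t: "t \<in> {0<..<y k}" for t
      proof -
        have "Z \<le> 2 ^ k / 4" using k by simp
        also have "\<dots> = (1/2) ^ k / (4 * (1/4) ^ k)"
          by (simp add: four power_divide field_simps)
        also have "\<dots> \<le> (1/2) ^ k / (4 * y k)" using y[of k] by (intro divide_left_mono) auto
        also have "\<dots> = (1/2) ^ k * (y k / (2 * y k)\<^sup>2)"
          using y(1)[of k] by (simp add: power2_eq_square)
        also have "\<dots> \<le> gk k t"
          unfolding gk_def using y(1)[of k] t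
          by (intro mult_left_mono divide_left_mono power_mono mult_pos_pos zero_less_power) auto
        also have "\<dots> \<le> g t" using gk_le_g t by simp
        finally show ?thesis .
      qed
      moreover have "\<forall>\<^sub>F t in at_right 0. t \<in> {0<..<y k}" by (rule eventually_at_right_real[OF y(1)])
      ultimately show "\<forall>\<^sub>F t in at_right 0. Z \<le> g t" by (rule eventually_mono[rotated])
    qed
  qed
  moreover have "\<exists>n. H (Y j n) > L * X j n" for j L
  proof -
    \<comment> \<open>The code of \<open>(j, m)\<close> is at least \<open>m\<close>, so
      \<open>j\<close> is met at a k with 2^k as large as desired. Then L X is less than half of
      (1/2)^k, a height that \<open>hk k\<close> has reached at \<open>?Y\<close>.\<close>
    obtain m where m: "2 * \<bar>L\<bar> < 2 ^ m" using real_arch_pow[of 2 "2 * \<bar>L\<bar>"] by auto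
    define k where "k = prod_encode (j, m)"
    have j: "fst (prod_decode k) = j" by (simp add: k_def)
    have "(2::real) ^ m \<le> 2 ^ k" unfolding k_def by (intro power_increasing le_prod_encode_2) simp
    then have kL: "2 * \<bar>L\<bar> < 2 ^ k" using m by linarith
    let ?Y = "Y j (\<nu> k)"
    have "L * X j (\<nu> k) \<le> \<bar>L\<bar> * \<bar>X j (\<nu> k)\<bar>" using abs_ge_self[of "L * X j (\<nu> k)"] by (simp add: abs_mult)
    also have "\<dots> \<le> \<bar>L\<bar> * (1/4) ^ k" using \<nu>[of k] j by (intro mult_left_mono) auto
    also have "\<dots> < (2 ^ k / 2) * (1/4) ^ k" using kL by (intro mult_strict_right_mono) auto
    also have "\<dots> = (1/2) ^ k * (1/2)"
      by (simp add: four power_divide field_simps)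
    also have "\<dots> \<le> hk k ?Y"
    proof -
      have "y k \<le> ?Y" using j by (simp add: y_def)
      then have "1/2 \<le> ?Y / (?Y + y k)" using y(1)[of k] by (simp add: field_simps)
      then show ?thesis unfolding hk_def by (intro mult_left_mono) auto
    qed
    also have "\<dots> \<le> H ?Y" using hk_le_H Y[of j "\<nu> k"] by simp
    finally show ?thesis by blast
  qed
  ultimately show ?thesis using that g_anti g_slow by blast
qed

text \<open>Whichever of |x - e| and |f x - e| is larger, the ratio lies between 1 and the square of
  their quotient, and that quotient tends to 1 because the derivative at \<open>e\<close> is
  1.\<close>

lemma slow_ratio_tendsto_1:
  fixes f g :: "real \<Rightarrow> real"
  assumes pos: "\<And>t. t > 0 \<Longrightarrow> g t > 0"
    and g: "\<And>t u. 0 < t \<Longrightarrow> t \<le> u \<Longrightarrow> g u \<le> g t" "\<And>t u. 0 < t \<Longrightarrow> t \<le> u \<Longrightarrow> g t \<le> (u / t)\<^sup>2 * g u"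
    and f: "f \<in> Diff1" "f e = e" "e \<in> {0..1}" "unit_deriv f e = 1"
  shows "((\<lambda>x. g \<bar>f x - e\<bar> / g \<bar>x - e\<bar>) \<longlongrightarrow> 1) (at e within {0..1})"
proof -
  define Q where "Q x = 1 / (\<bar>f x - e\<bar> / \<bar>x - e\<bar>)\<^sup>2" for x
  have "((\<lambda>x. \<bar>f x - e\<bar> / \<bar>x - e\<bar>) \<longlongrightarrow> 1) (at e within {0..1})"
    using abs_quotient_tendsto_deriv[OF has_unit_deriv[OF Diff1_C1[OF f(1)] f(3)] f(2)] f(4) by simp
  from tendsto_divide[OF tendsto_const[of 1] tendsto_power[OF this, of 2]]
  have Q: "(Q \<longlongrightarrow> 1) (at e within {0..1})" by (simp add: Q_def[abs_def])
  have "min 1 (Q x) \<le> g \<bar>f x - e\<bar> / g \<bar>x - e\<bar> \<and> g \<bar>f x - e\<bar> / g \<bar>x - e\<bar> \<le> max 1 (Q x)"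
    if x: "x \<in> {0..1}" "x \<noteq> e" for x
  proof -
    let ?t = "\<bar>x - e\<bar>" and ?u = "\<bar>f x - e\<bar>"
    have "f x \<noteq> f e" using Diff1_bij_betw[OF f(1)] x f(3) by (auto simp: bij_betw_def inj_on_def)
    then have tu: "?t > 0" "?u > 0" using x(2) f(2) by auto
    have Q_eq: "Q x = (?t / ?u)\<^sup>2" using tu by (simp add: Q_def power_divide)
    show ?thesis
    proof (cases "?t \<le> ?u")
      case True
      have "g ?t \<le> (?u / ?t)\<^sup>2 * g ?u" by (rule g(2)[OF tu(1) True])
      then have "(?t / ?u)\<^sup>2 * g ?t \<le> g ?u" using tu by (simp add: power_divide field_simps)
      then have "Q x \<le> g ?u / g ?t" using pos[OF tu(1)] by (simp add: Q_eq pos_le_divide_eq)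
      moreover have "g ?u / g ?t \<le> 1" using g(1)[OF tu(1) True] pos[OF tu(1)] by simp
      ultimately show ?thesis by auto
    next
      case False
      then have le: "?u \<le> ?t" by simp
      have "g ?u / g ?t \<le> Q x"
        using g(2)[OF tu(2) le] pos[OF tu(1)] by (simp add: Q_eq pos_divide_le_eq)
      moreover have "1 \<le> g ?u / g ?t" using g(1)[OF tu(2) le] pos[OF tu(1)] by simp
      ultimately show ?thesis by auto
    qed
  qed
  then have ev: "\<forall>\<^sub>F x in at e within {0..1}. min 1 (Q x) \<le> g \<bar>f x - e\<bar> / g \<bar>x - e\<bar>"
    "\<forall>\<^sub>F x in at e within {0..1}. g \<bar>f x - e\<bar> / g \<bar>x - e\<bar> \<le> max 1 (Q x)"
    unfolding eventually_at_filter by (auto intro!: always_eventually)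
  have "((\<lambda>x. min 1 (Q x)) \<longlongrightarrow> 1) (at e within {0..1})" "((\<lambda>x. max 1 (Q x)) \<longlongrightarrow> 1) (at e within {0..1})"
    using tendsto_min[OF tendsto_const Q, of 1] tendsto_max[OF tendsto_const Q, of 1] by auto
  then show ?thesis by (rule tendsto_sandwich[OF ev])
qed

section \<open>Infima of orbits and the parabolic case\<close>

context interval_action
begin

text \<open>Each \<open>\<phi> b\<close> permutes the orbit and preserves order, hence cannot move
  the infimum up; the same for \<open>inv b\<close> gives equality.\<close>

lemma Inf_orbit_global_fixed:
  assumes x: "x \<in> {0..1}"
  shows "Inf ((\<lambda>a. \<phi> a x) ` carrier G) \<in> global_fixed"
proof -
  let ?O = "(\<lambda>a. \<phi> a x) ` carrier G"
  define i where "i = Inf ?O"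
  have O: "?O \<noteq> {}" "bdd_below ?O" using action_mem x by (auto intro!: bdd_belowI[of _ 0])
  have lower: "i \<le> \<phi> a x" if "a \<in> carrier G" for a
    unfolding i_def using O(2) that by (intro cInf_lower) auto
  have i: "i \<in> {0..1}"
  proof -
    have "0 \<le> i" unfolding i_def using O(1) action_mem x by (intro cInf_greatest) auto
    moreover have "i \<le> 1" using lower[of \<one>] action_mem[of \<one> x] x by auto
    ultimately show ?thesis by simp
  qed
  have le: "\<phi> b i \<le> i" if b: "b \<in> carrier G" for b
    unfolding i_def
  proof (rule cInf_greatest[OF O(1)])
    fix o' assume "o' \<in> ?O"
    then obtain a where a: "a \<in> carrier G" "o' = \<phi> a x" by blast
    have "\<phi> b i \<le> \<phi> b (\<phi> (inv b \<otimes> a) x)"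
      using action_le[OF b i action_mem[of "inv b \<otimes> a" x]] lower[of "inv b \<otimes> a"] a b x by simp
    also have "\<dots> = \<phi> a x"
      using action_mult[of "inv b" a x] action_inv(2)[OF b action_mem[of a x]] a b x by simp
    finally show "\<phi> b (Inf ?O) \<le> o'" using a(2) by (simp add: i_def)
  qed
  have "\<phi> b i = i" if b: "b \<in> carrier G" for b
  proof (rule antisym[OF le[OF b]])
    have "\<phi> b (\<phi> (inv b) i) \<le> \<phi> b i"
      using action_le[OF b action_mem[of "inv b" i] i] le[of "inv b"] b i by simp
    then show "i \<le> \<phi> b i" using action_inv(2)[OF b i] by simp
  qed
  then show ?thesis using i unfolding global_fixed_def i_def by blast
qed

lemma parabolic_approximation:
  assumes nontriv: "a0 \<in> carrier G" "x0 \<in> {0..1}" "\<phi> a0 x0 \<noteq> x0"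
    and parab: "\<And>a e. a \<in> carrier G \<Longrightarrow> e \<in> global_fixed \<Longrightarrow> unit_deriv (\<phi> a) e = 1"
    and S: "finite S" "S \<subseteq> carrier G" and \<epsilon>: "\<epsilon> > 0"
  shows "\<exists>\<phi>'. C1_action G \<phi>' \<and> (topologically_conjugate G \<phi> \<phi>' \<and> \<not> Lipschitz_conjugate G \<phi> \<phi>') \<and>
    (\<forall>s\<in>S. C1_norm (\<lambda>x. \<phi>' s x - \<phi> s x) \<le> \<epsilon>)"
proof -
  let ?O = "(\<lambda>a. \<phi> a x0) ` carrier G"
  define e where "e = Inf ?O"
  have e_fixed: "e \<in> global_fixed" unfolding e_def by (rule Inf_orbit_global_fixed[OF nontriv(2)])
  then have e: "e \<in> {0..1}" "\<And>a. a \<in> carrier G \<Longrightarrow> \<phi> a e = e" by (auto simp: global_fixed_def)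
  have O: "?O \<noteq> {}" "bdd_below ?O" using action_mem nontriv(2) by (auto intro!: bdd_belowI[of _ 0])
  have "e \<le> x0"
    using cInf_lower[OF imageI[OF one_closed] O(2)] action_one[OF nontriv(2)] by (simp add: e_def)
  moreover have "e \<noteq> x0" using e(2)[OF nontriv(1)] nontriv(3) by blast
  ultimately have ex0: "e < x0" by simp
  have "\<exists>a\<in>carrier G. \<phi> a x0 < e + 1 / Suc n" for n
    using cInf_lessD[OF O(1), of "e + 1 / Suc n"] by (auto simp: e_def)
  then obtain \<gamma> where \<gamma>: "\<And>n. \<gamma> n \<in> carrier G" "\<And>n. \<phi> (\<gamma> n) x0 < e + 1 / Suc n" by metis
  have \<gamma>_lim: "(\<lambda>n. \<phi> (\<gamma> n) x0) \<longlonglongrightarrow> e"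
  proof (rule tendsto_sandwich)
    show "\<forall>\<^sub>F n in sequentially. e \<le> \<phi> (\<gamma> n) x0"
      using cInf_lower[OF _ O(2)] \<gamma>(1) by (simp add: e_def)
    show "\<forall>\<^sub>F n in sequentially. \<phi> (\<gamma> n) x0 \<le> e + 1 / Suc n"
      using \<gamma>(2) by (simp add: less_imp_le)
    show "(\<lambda>n. e + 1 / real (Suc n)) \<longlonglongrightarrow> e"
      using tendsto_add[OF tendsto_const LIMSEQ_Suc[OF lim_1_over_n], of e] by simp
  qed simp
  \<comment> \<open>These points start at \<open>x0\<close> and decrease to \<open>e\<close>, so
    some \<open>w m\<close> lies below any given value \<open>c z\<close> above
    \<open>e\<close>.\<close>
  define w where "w m = e + (x0 - e) / real (Suc m)" for m
  have w: "w m \<in> {0..1}" "e < w m" for m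
  proof -
    have "(x0 - e) / real (Suc m) \<le> x0 - e" using ex0 by (simp add: pos_divide_le_eq)
    then show "w m \<in> {0..1}" "e < w m" using ex0 e(1) nontriv(2) by (auto simp: w_def intro: add_nonneg_nonneg)
  qed
  \<comment> \<open>The pairs \<open>(z, w)\<close> with \<open>z\<close> rational stand in for the unknown pairs \<open>(z, c z)\<close>, of which
    there are uncountably many.  For some \<open>z\<close> the sequence need not converge; these get \<open>X = 0\<close>.\<close>
  define \<xi> where "\<xi> i n = \<phi> (\<gamma> n) (real_of_rat (from_nat i))" for i n
  define X where "X j n = (let i = fst (prod_decode j) in
    if convergent (\<xi> i) then \<bar>\<xi> i n - lim (\<xi> i)\<bar> else 0)" for j n
  define Y where "Y j n = \<phi> (\<gamma> n) (w (snd (prod_decode j))) - e" for j n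
  have "X j \<longlonglongrightarrow> 0" for j
  proof (cases "convergent (\<xi> (fst (prod_decode j)))")
    case True
    then have "(\<lambda>n. \<xi> (fst (prod_decode j)) n - lim (\<xi> (fst (prod_decode j)))) \<longlonglongrightarrow> 0"
      by (simp add: convergent_LIMSEQ_iff LIM_zero)
    then have "(\<lambda>n. \<bar>\<xi> (fst (prod_decode j)) n - lim (\<xi> (fst (prod_decode j)))\<bar>) \<longlonglongrightarrow> 0"
      by (rule tendsto_rabs_zero)
    then show ?thesis using True by (simp add: X_def[abs_def] Let_def)
  qed (simp add: X_def[abs_def] Let_def)
  moreover have Y_pos: "Y j n > 0" for j n
    using action_less[OF \<gamma>(1) e(1) w(1)] w(2) e(2)[OF \<gamma>(1)] by (simp add: Y_def)
  ultimately obtain H g where Hg: "singular_profile H g"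
    and slow: "\<And>t u. 0 < t \<Longrightarrow> t \<le> u \<Longrightarrow> g u \<le> g t" "\<And>t u. 0 < t \<Longrightarrow> t \<le> u \<Longrightarrow> g t \<le> (u / t)\<^sup>2 * g u"
    and beats: "\<And>j L. \<exists>n. H (Y j n) > L * X j n"
    using diagonal_profile[of X Y] by blast
  interpret singular_profile H g by (rule Hg)
  obtain M where M: "M > 0" "\<And>s x. s \<in> S \<Longrightarrow> x \<in> {0..1} \<Longrightarrow> unit_deriv (\<phi> s) x \<le> M"
    using unit_deriv_action_bounded[OF S] by blast
  show ?thesis
  proof (rule singular_approximation[OF Hg e _ S \<epsilon>, where r="\<lambda>_. 1" and \<epsilon>'="\<epsilon> / (4 * M)"])
    show "((\<lambda>x. g \<bar>\<phi> a x - e\<bar> / g \<bar>x - e\<bar>) \<longlongrightarrow> 1) (at e within {0..1})" if "a \<in> carrier G" for a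
      by (rule slow_ratio_tendsto_1[OF g_pos slow action_Diff1[OF that] e(2)[OF that] e(1) parab[OF that e_fixed]])
  next
    fix a and x :: real assume "a \<in> S" "x \<in> {0..1}"
    then have "unit_deriv (\<phi> a) x * (\<epsilon> / (4 * M)) \<le> M * (\<epsilon> / (4 * M))"
      using M \<epsilon> by (intro mult_right_mono) auto
    then show "unit_deriv (\<phi> a) x * (\<epsilon> / (4 * M)) \<le> \<epsilon> / 4" using M(1) by simp
  next
    show "\<bar>1 - 1 :: real\<bar> < \<epsilon> / (4 * M)" using \<epsilon> M(1) by simp
  next
    fix c c' L assume c: "commuting_homeo c c'"
      and sing: "\<And>x. x \<in> {0..1} \<Longrightarrow> H \<bar>c x - e\<bar> \<le> L * \<bar>x - c' e\<bar>"
    note cD = commuting_homeoD[OF c]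
    have cont: "continuous_on {0..1} c" "continuous_on {0..1} c'"
      using c by (auto simp: commuting_homeo_def homeomorphism_def)
    have c'_comm: "c' (\<phi> a x) = \<phi> a (c' x)" if "a \<in> carrier G" "x \<in> {0..1}" for a x
      using cD(3)[OF action_mem[OF that(1) cD(2)[OF that(2)]]] cD(5)[OF cD(2)[OF that(2)] that(1)]
        cD(4)[OF that(2)] by simp
    \<comment> \<open>These are the preimages of \<open>e\<close> and \<open>x0\<close> under
      \<open>c\<close>. Since \<open>c'\<close> commutes with the action, each
      \<open>\<gamma> n\<close> fixes \<open>e'\<close>, and the images of \<open>x'\<close>
      converge to \<open>e'\<close>.\<close>
    define e' x' where "e' = c' e" and "x' = c' x0"
    have mem: "e' \<in> {0..1}" "x' \<in> {0..1}" using cD(2) e(1) nontriv(2) by (auto simp: e'_def x'_def)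
    have cc: "c e' = e" "c x' = x0" using cD(4) e(1) nontriv(2) by (auto simp: e'_def x'_def)
    have e'_fix: "\<phi> a e' = e'" if "a \<in> carrier G" for a
      using c'_comm[OF that e(1)] e(2)[OF that] by (simp add: e'_def)
    have "(\<lambda>n. c' (\<phi> (\<gamma> n) x0)) \<longlonglongrightarrow> c' e"
      using continuous_on_tendsto_compose[OF cont(2) \<gamma>_lim e(1)] action_mem[OF \<gamma>(1) nontriv(2)] by simp
    then have x'_lim: "(\<lambda>n. \<phi> (\<gamma> n) x') \<longlonglongrightarrow> e'"
      using c'_comm[OF \<gamma>(1) nontriv(2)] by (simp add: e'_def x'_def)
    have inj: "inj_on c {0..1}" by (rule inj_on_inverseI[where g=c']) (rule cD(3))
    \<comment> \<open>Being continuous and injective, \<open>c\<close> is monotone on the segment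
      between \<open>e'\<close> and \<open>x'\<close>, in one direction or the other.\<close>
    have between: "e < c z \<and> c z < x0" if z: "min e' x' < z" "z < max e' x'" for z
    proof -
      have sub: "{min e' x'..max e' x'} \<subseteq> {0..1}" using mem by auto
      show ?thesis
        using continuous_inj_imp_mono[OF z continuous_on_subset[OF cont(1) sub] inj_on_subset[OF inj sub]]
          cc ex0 by (cases "e' \<le> x'") auto
    qed
    have "min e' x' < max e' x'" using cc ex0 by (cases "e' = x'") auto
    then obtain \<zeta> :: rat where \<zeta>: "min e' x' < real_of_rat \<zeta>" "real_of_rat \<zeta> < max e' x'"
      using of_rat_dense by blast
    let ?z = "real_of_rat \<zeta>"
    have z: "?z \<in> {0..1}" using \<zeta> mem unfolding atLeastAtMost_iff by linarith
    \<comment> \<open>This puts \<open>w m\<close> below \<open>c ?z\<close>, so that the pair with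
      index \<open>j\<close> replaces the pair formed by \<open>?z\<close> and
      \<open>c ?z\<close>.\<close>
    obtain m where m: "(x0 - e) / real (Suc m) < c ?z - e"
    proof -
      have "0 < (c ?z - e) / (x0 - e)" using between[OF \<zeta>] by simp
      then obtain m where "inverse (real (Suc m)) < (c ?z - e) / (x0 - e)"
        using reals_Archimedean by blast
      then show ?thesis using that[of m] ex0 by (simp add: field_simps)
    qed
    define j where "j = prod_encode (to_nat \<zeta>, m)"
    have \<xi>: "\<xi> (fst (prod_decode j)) n = \<phi> (\<gamma> n) ?z" for n by (simp add: \<xi>_def j_def)
    \<comment> \<open>The \<open>\<gamma> n\<close> preserve order and fix \<open>e'\<close>, so the
      image of \<open>?z\<close> is trapped between \<open>e'\<close> and the image of
      \<open>x'\<close>. Hence the sequence of \<open>?z\<close> converges to \<open>e'\<close>, and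
      \<open>X j\<close> is not the default 0 but the distance to \<open>e'\<close>.\<close>
    have squeeze: "\<bar>\<phi> (\<gamma> n) ?z - e'\<bar> \<le> \<bar>\<phi> (\<gamma> n) x' - e'\<bar>" for n
      using action_le[OF \<gamma>(1) z mem(2), of n] action_le[OF \<gamma>(1) mem(2) z, of n]
        action_le[OF \<gamma>(1) z mem(1), of n] action_le[OF \<gamma>(1) mem(1) z, of n] e'_fix[OF \<gamma>(1), of n] \<zeta>
      by (cases "e' \<le> x'") auto
    have z_lim: "\<xi> (fst (prod_decode j)) \<longlonglongrightarrow> e'"
      unfolding \<xi>[abs_def]
    proof (rule LIM_zero_cancel, rule tendsto_rabs_zero_cancel,
        rule tendsto_sandwich[where f="\<lambda>_. 0" and h="\<lambda>n. \<bar>\<phi> (\<gamma> n) x' - e'\<bar>"])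
      show "(\<lambda>n. \<bar>\<phi> (\<gamma> n) x' - e'\<bar>) \<longlonglongrightarrow> 0"
        by (intro tendsto_rabs_zero LIM_zero x'_lim)
    qed (use squeeze in auto)
    have X_eq: "X j n = \<bar>\<phi> (\<gamma> n) ?z - e'\<bar>" for n
      using convergentI[OF z_lim] limI[OF z_lim] \<xi>[of n] by (simp add: X_def Let_def)
    \<comment> \<open>Transported by \<open>\<gamma> n\<close>, the bound on \<open>c\<close> gives
      one constant \<open>L\<close> for all \<open>n\<close>, which \<open>beats\<close> rules
      out.\<close>
    have "H (Y j n) \<le> L * X j n" for n
    proof -
      have "w m \<le> c ?z" using m by (simp add: w_def)
      then have "\<phi> (\<gamma> n) (w m) \<le> \<phi> (\<gamma> n) (c ?z)" using action_le[OF \<gamma>(1) w(1) cD(1)[OF z]] by simp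
      then have "Y j n \<le> \<bar>c (\<phi> (\<gamma> n) ?z) - e\<bar>"
        using cD(5)[OF z \<gamma>(1)] by (simp add: Y_def j_def)
      then have "H (Y j n) \<le> H \<bar>c (\<phi> (\<gamma> n) ?z) - e\<bar>"
        by (intro H_mono less_imp_le[OF Y_pos])
      also have "\<dots> \<le> L * X j n"
        unfolding X_eq e'_def by (rule sing[OF action_mem[OF \<gamma>(1) z]])
      finally show ?thesis .
    qed
    then show False using beats[of L j] by (simp add: not_less[symmetric])
  qed
qed

section \<open>The dichotomy between the two cases\<close>

lemma unit_deriv_action_inv:
  assumes a: "a \<in> carrier G" and e: "e \<in> global_fixed"
  shows "unit_deriv (\<phi> (inv a)) e * unit_deriv (\<phi> a) e = 1"
proof -
  have e01: "e \<in> {0..1}" and fe: "\<phi> a e = e" using a e by (auto simp: global_fixed_def)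
  have im: "\<phi> a ` {0..1} = {0..1}" using Diff1_bij_betw[OF action_Diff1[OF a]] by (simp add: bij_betw_def)
  have "((\<phi> (inv a) \<circ> \<phi> a) has_real_derivative unit_deriv (\<phi> (inv a)) e * unit_deriv (\<phi> a) e) (at e within {0..1})"
    by (rule DERIV_image_chain)
      (use has_unit_deriv[OF Diff1_C1[OF action_Diff1] e01] a fe im in auto)
  then have "((\<lambda>x. x) has_real_derivative unit_deriv (\<phi> (inv a)) e * unit_deriv (\<phi> a) e) (at e within {0..1})"
    by (rule has_field_derivative_transform_within[OF _ zero_less_one e01]) (simp add: action_inv(1)[OF a])
  from unit_deriv_eq[OF e01 this] unit_deriv_eq[OF e01 DERIV_ident] show ?thesis by simp
qed

text \<open>If no derivative at a global fixed point is below 1, passing to inverses shows that none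
  is above 1 either, so the hyperbolic and the parabolic case are exhaustive.\<close>

theorem C1_approximation:
  assumes "a0 \<in> carrier G" "x0 \<in> {0..1}" "\<phi> a0 x0 \<noteq> x0"
  shows "C1_approximated_by G \<phi>
    (\<lambda>\<phi>'. topologically_conjugate G \<phi> \<phi>' \<and> \<not> Lipschitz_conjugate G \<phi> \<phi>')"
  unfolding C1_approximated_by_def
proof (intro allI impI)
  fix S and \<epsilon> :: real assume "finite S \<and> generating_set G S" and \<epsilon>: "\<epsilon> > 0"
  then have S: "finite S" "S \<subseteq> carrier G" by (auto simp: generating_set_def)
  show "\<exists>\<phi>'. C1_action G \<phi>' \<and> (topologically_conjugate G \<phi> \<phi>' \<and> \<not> Lipschitz_conjugate G \<phi> \<phi>') \<and>
    (\<forall>s\<in>S. C1_norm (\<lambda>x. \<phi>' s x - \<phi> s x) \<le> \<epsilon>)"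
  proof (cases "\<exists>s e. s \<in> carrier G \<and> e \<in> global_fixed \<and> unit_deriv (\<phi> s) e < 1")
    case True
    then show ?thesis using hyperbolic_approximation[OF _ _ _ S \<epsilon>] by blast
  next
    case False
    have "unit_deriv (\<phi> a) e = 1" if a: "a \<in> carrier G" and e: "e \<in> global_fixed" for a e
    proof -
      have "unit_deriv (\<phi> a) e \<ge> 1" "unit_deriv (\<phi> (inv a)) e \<ge> 1"
        using False a e inv_closed[OF a] not_less by blast+
      then show ?thesis
        using unit_deriv_action_inv[OF a e] mult_mono[of 1 "unit_deriv (\<phi> (inv a)) e" "unit_deriv (\<phi> a) e" "unit_deriv (\<phi> a) e"]
        by simp
    qed
    then show ?thesis by (rule parabolic_approximation[OF assms _ S \<epsilon>])
  qed
qed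

end

section \<open>Application to faithful actions of the semidirect products\<close>

theorem proposition4p15:
  fixes A :: "rat^'d^'d" and H :: "(rat^'d) set"
    and \<phi> :: "int \<times> (rat^'d) \<Rightarrow> real \<Rightarrow> real"
  assumes "invertible A"
    and "subgroup H additive_group"
    and "\<And>h. h \<in> H \<Longrightarrow> A *v h \<in> H"
    and "\<And>h. h \<in> H \<Longrightarrow> matrix_inv A *v h \<in> H"
    and "rank_Q H = CARD('d)"
    and "finitely_generated_group (semidirect_Z A H)"
    and "faithful_C1_action (semidirect_Z A H) \<phi>"
  shows "C1_approximated_by (semidirect_Z A H) \<phi>
           (\<lambda>\<phi>'. topologically_conjugate (semidirect_Z A H) \<phi> \<phi>' \<and>
                 \<not> Lipschitz_conjugate (semidirect_Z A H) \<phi> \<phi>')"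
proof -
  let ?G = "semidirect_Z A H"
  interpret interval_action ?G \<phi>
    using assms(6,7)
    by (simp add: interval_action_def interval_action_axioms_def finitely_generated_group_def faithful_C1_action_def)
  have "0 \<in> H" using subgroup.one_closed[OF assms(2)] by (simp add: additive_group_def)
  then have a: "(1, 0) \<in> carrier ?G" and one: "\<one>\<^bsub>?G\<^esub> = (0, 0)" by (auto simp: semidirect_Z_def)
  \<comment> \<open>Faithfulness is applied to the generator of the factor Z. Distinct maps that are
    extensional on the interval differ at one of its points, which serves as the point with
    nontrivial orbit.\<close>
  have "\<phi> (1, 0) \<noteq> \<phi> \<one>\<^bsub>?G\<^esub>"
    using assms(7) inj_onD[of \<phi> "carrier ?G" "(1, 0)" "\<one>\<^bsub>?G\<^esub>"] a one_closed one
    by (auto simp: faithful_C1_action_def)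
  moreover have "\<phi> (1, 0) \<in> extensional {0..1}" "\<phi> \<one>\<^bsub>?G\<^esub> \<in> extensional {0..1}"
    using Diff1_Bij[OF action_Diff1] a one_closed by (auto simp: Bij_def)
  ultimately obtain x where "x \<in> {0..1}" "\<phi> (1, 0) x \<noteq> \<phi> \<one>\<^bsub>?G\<^esub> x"
    using extensionalityI by blast
  then show ?thesis using C1_approximation[OF a] action_one by simp
qed

end
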